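(* Let $X$ be a Banach space and let $G:[0,1]\to cwk(X)$ be variationally Henstock integrable. If $0\in G(t)$ for almost every $t\in[0,1]$, then $G$ is Birkhoff integrable.
   Context: $[0,1]$ carries Lebesgue measure $\lambda$; $\mathcal{L}$ is the family of Lebesgue measurable subsets of $[0,1]$, $\mathcal{I}$ the family of all closed subintervals; $|\cdot|$ denotes length (Lebesgue measure). $cwk(X)$ is the family of all non-empty convex weakly compact subsets of $X$, with Minkowski addition, multiplication by scalars, and the Hausdorff distance $d_H$. A gauge is a function $\delta:[0,1]\to(0,\infty)$. A Perron partition of $[0,1]$ is a finite collection $\{(I_1,t_1),\dots,(I_p,t_p)\}$ of non-overlapping closed subintervals with union $[0,1]$ and points $t_i\in I_i$; it is $\delta$-fine if $I_i\subset(t_i-\delta(t_i),t_i+\delta(t_i))$ for all $i$. $\Gamma:[0,1]\to cwk(X)$ is variationally Henstock integrable if there is a finitely additive $\Phi_\Gamma:\mathcal{I}\to cwk(X)$ such that for every $\varepsilon>0$ there is a gauge $\delta$ with $\sum_{j=1}^p d_H(\Phi_\Gamma(I_j),\Gamma(t_j)|I_j|)<\varepsilon$ for every $\delta$-fine Perron partition of $[0,1]$. $\Gamma:[0,1]\to cwk(X)$ is Birkhoff integrable if there is a set $\Phi\in cwk(X)$ such that for every $\varepsilon>0$ there is a countable partition $\Pi_0$ of $[0,1]$ into sets of $\mathcal{L}$ such that for every countable partition $\Pi=(A_n)_n$ of $[0,1]$ in $\mathcal{L}$ finer than $\Pi_0$ and any choice of points $t_n\in A_n$, the series $\sum_n|A_n|\Gamma(t_n)$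 is unconditionally convergent (in $d_H$) and $d_H(\Phi,\sum_n|A_n|\Gamma(t_n))<\varepsilon$. *)

theory Defs
  imports "HOL-Analysis.Analysis" "HOL-Library.Set_Algebras"
begin

text \<open>Sums of sets are Minkowski sums, via the \<open>comm_monoid_add\<close> instance of
  \<^theory>\<open>HOL-Library.Set_Algebras\<close>; its zero is \<open>{0}\<close>. The dilate of \<open>A\<close> by \<open>c\<close> is \<open>(*\<^sub>R) c ` A\<close>.\<close>

definition weak_topology :: "'a::real_normed_vector topology" where
  "weak_topology =
     topology_generated_by {f -` U | (f :: 'a \<Rightarrow> real) U. bounded_linear f \<and> open U}"

definition cwk :: "'a::real_normed_vector set set" where
  "cwk = {C. C \<noteq> {} \<and> convex C \<and> compactin weak_topology C}"

text \<open>The real-valued suprema are meaningful for non-empty bounded sets only; members of \<^const>\<open>cwk\<close>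
  are norm bounded by the uniform boundedness principle.\<close>

definition hausdorff_dist :: "'a::metric_space set \<Rightarrow> 'a set \<Rightarrow> real" where
  "hausdorff_dist A B = max (SUP a\<in>A. infdist a B) (SUP b\<in>B. infdist b A)"

text \<open>Degenerate intervals \<open>{a..a}\<close> are admitted, as they are in \<^const>\<open>tagged_division_of\<close>.
  This is harmless: additivity forces the value \<open>{0}\<close> on them.\<close>

definition closed_subintervals :: "real set set" where
  "closed_subintervals = {{a..b} | a b. 0 \<le> a \<and> a \<le> b \<and> b \<le> 1}"

definition finitely_additive :: "(real set \<Rightarrow> 'a::real_normed_vector set) \<Rightarrow> bool" where
  "finitely_additive \<Phi> \<longleftrightarrow>
     (\<forall>I\<in>closed_subintervals. \<forall>J\<in>closed_subintervals.
        interior I \<inter> interior J = {} \<and> I \<union> J \<in> closed_subintervals \<longrightarrow> \<Phi> (I \<union> J) = \<Phi> I + \<Phi> J)"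

text \<open>A Perron partition is a \<^const>\<open>tagged_division_of\<close> of the unit interval. Its elements are pairs
  \<open>(t, I)\<close>, the tag first.\<close>

definition variationally_Henstock_integrable :: "(real \<Rightarrow> 'a::real_normed_vector set) \<Rightarrow> bool" where
  "variationally_Henstock_integrable \<Gamma> \<longleftrightarrow>
     (\<exists>\<Phi> \<in> closed_subintervals \<rightarrow> cwk. finitely_additive \<Phi> \<and>
        (\<forall>\<epsilon>>0. \<exists>\<delta> :: real \<Rightarrow> real. (\<forall>t\<in>{0..1}. \<delta> t > 0) \<and>
           (\<forall>P. P tagged_division_of {0..1} \<and> (\<lambda>t. ball t (\<delta> t)) fine P \<longrightarrow>
              (\<Sum>(t, I)\<in>P. hausdorff_dist (\<Phi> I) ((*\<^sub>R) (measure lebesgue I) ` \<Gamma> t)) < \<epsilon>)))"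

definition cwk_sums :: "(nat \<Rightarrow> 'a::real_normed_vector set) \<Rightarrow> 'a set \<Rightarrow> bool" where
  "cwk_sums B S \<longleftrightarrow> S \<in> cwk \<and> (\<lambda>N. hausdorff_dist (\<Sum>n<N. B n) S) \<longlonglongrightarrow> 0"

definition unconditionally_convergent :: "(nat \<Rightarrow> 'a::real_normed_vector set) \<Rightarrow> bool" where
  "unconditionally_convergent B \<longleftrightarrow>
     (\<forall>\<pi> :: nat \<Rightarrow> nat. bij \<pi> \<longrightarrow> (\<exists>S. cwk_sums (\<lambda>n. B (\<pi> n)) S))"

text \<open>Countable partitions are sequences in which blocks may be empty, so that finite partitions
  are covered.\<close>

definition countable_partition :: "(nat \<Rightarrow> real set) \<Rightarrow> bool" where
  "countable_partition A \<longleftrightarrow>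
     range A \<subseteq> sets lebesgue \<and> disjoint_family A \<and> (\<Union>n. A n) = {0..1}"

definition finer_than :: "(nat \<Rightarrow> real set) \<Rightarrow> (nat \<Rightarrow> real set) \<Rightarrow> bool" where
  "finer_than A B \<longleftrightarrow> (\<forall>n. \<exists>m. A n \<subseteq> B m)"

text \<open>For an empty block there is no point to choose; the tag \<open>t n\<close> is then an arbitrary point
  of the unit interval and the corresponding term of the series is \<open>{0}\<close>.\<close>

definition Birkhoff_integrable :: "(real \<Rightarrow> 'a::real_normed_vector set) \<Rightarrow> bool" where
  "Birkhoff_integrable \<Gamma> \<longleftrightarrow>
     (\<exists>\<Phi>\<in>cwk. \<forall>\<epsilon>>0. \<exists>A\<^sub>0. countable_partition A\<^sub>0 \<and>
        (\<forall>A t. countable_partition A \<and> finer_than A A\<^sub>0 \<and>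
               (\<forall>n. t n \<in> {0..1} \<and> (A n \<noteq> {} \<longrightarrow> t n \<in> A n)) \<longrightarrow>
           unconditionally_convergent (\<lambda>n. (*\<^sub>R) (measure lebesgue (A n)) ` \<Gamma> (t n)) \<and>
           (\<exists>S. cwk_sums (\<lambda>n. (*\<^sub>R) (measure lebesgue (A n)) ` \<Gamma> (t n)) S \<and>
                hausdorff_dist \<Phi> S < \<epsilon>)))"

end

theory Submission
  imports Defs
begin

text \<open>The support function turns sets into vectors: sending \<open>C\<close> to \<open>f \<mapsto> sup f(C)\<close>, with \<open>f\<close> in the dual
  unit ball, is additive, positively homogeneous and isometric from the non-empty bounded convex sets with the
  Hausdorff distance into a Banach space of bounded continuous functions. It carries \<open>G\<close> to a function \<open>g\<close>
  with a variational primitive \<open>F\<close>, and \<open>0 \<in> G t\<close> becomes nonnegativity of every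
  coordinate of \<open>g t\<close>. The theorem is then about a Banach-valued \<open>g\<close> that is positive almost everywhere
  with respect to a norming family of functionals \<open>L\<close>.

  By Vitali's covering theorem \<open>F\<close> has derivative \<open>g\<close> almost everywhere, so \<open>g\<close> is an almost everywhere
  limit of step functions. Consequently \<open>[0,1]\<close> splits into countably many measurable pieces on each of which \<open>g\<close> is
  bounded and which are either null or of small oscillation (\<open>small_oscillation_partition\<close>).
  Each \<open>L \<circ> g\<close> is Henstock integrable and nonnegative almost everywhere, hence Lebesgue integrable, and
  defines a measure, its mass, of total \<open>L (F 1) - L (F 0)\<close>.

  The heart of the proof is that these masses are absolutely continuous uniformly in \<open>L\<close>
  (\<open>mass_concentrated\<close>, \<open>mass_uniformly_continuous\<close>). A single fine division has finitely many tags,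
  so its tags meet only finitely many pieces. Its Riemann sum is close to the total mass for all \<open>L\<close> at once, and
  at the same time it hardly exceeds the mass of these finitely many pieces. By positivity little mass
  is left elsewhere, and on finitely many pieces \<open>g\<close> is bounded.

  For a partition with small oscillation, every block sum then differs little from the mass of
  a union of blocks, which makes the series \<open>\<Sum>n. |A n| g (t n)\<close> Cauchy and its sum close to \<open>F 1 - F 0\<close>
  (\<open>positive_variational_Riemann_sums\<close>). Rearranging a partition gives another partition, so the
  convergence is unconditional. Finally, the sums return to \<open>cwk\<close>: the set of all sums of
  selections is weakly compact by Tychonoff's theorem (\<open>cwk_series\<close>).\<close>

section \<open>The Hahn-Banach theorem and separation\<close>

text \<open>Homogeneity is imposed as an inequality only; applying it to \<open>c\<close> and to \<open>1 / c\<close> gives the equality,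
  and this form is what the infimum constructions below produce.\<close>

definition sublinear :: "('a::real_vector \<Rightarrow> real) \<Rightarrow> bool" where
  "sublinear p \<longleftrightarrow> p 0 = 0 \<and> (\<forall>x y. p (x + y) \<le> p x + p y) \<and> (\<forall>c>0. \<forall>x. p (c *\<^sub>R x) \<le> c * p x)"

lemma sublinear_scale:
  assumes "sublinear p" "c \<ge> 0"
  shows "p (c *\<^sub>R x) = c * p x"
proof (cases "c = 0")
  case True
  then show ?thesis using assms by (simp add: sublinear_def)
next
  case False
  then have "c > 0" using assms by simp
  then have "p ((1 / c) *\<^sub>R (c *\<^sub>R x)) \<le> (1 / c) * p (c *\<^sub>R x)"
    using assms(1) zero_less_divide_1_iff[of c] unfolding sublinear_def by blast
  then have "c * p x \<le> p (c *\<^sub>R x)"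
    using \<open>c > 0\<close> by (simp add: field_simps)
  moreover have "p (c *\<^sub>R x) \<le> c * p x"
    using assms(1) \<open>c > 0\<close> by (simp add: sublinear_def)
  ultimately show ?thesis by simp
qed

lemma sublinear_minus_le:
  assumes "sublinear p"
  shows "- p (- x) \<le> p x"
proof -
  have "p 0 \<le> p x + p (- x)"
    using assms unfolding sublinear_def by (metis add.right_inverse)
  then show ?thesis using assms by (simp add: sublinear_def)
qed

text \<open>Both uses of sublinear functionals come from one construction: the infimum over \<open>l \<ge> 0\<close> and
  \<open>e \<in> E\<close> of \<open>q (x + l e) - l r\<close>. It stays finite because \<open>q \<ge> r\<close> on \<open>E\<close>, and it is subadditive because \<open>E\<close> is
  convex. With \<open>E\<close> a single point it shows that minimal functionals are linear, and with \<open>E\<close> a translate of a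
  convex set it separates that set from a point.\<close>

lemma sublinear_lowering:
  fixes q :: "'a::real_vector \<Rightarrow> real"
  assumes q: "sublinear q" and E: "convex E" "E \<noteq> {}" and r: "\<And>e. e \<in> E \<Longrightarrow> r \<le> q e"
  obtains q' where "sublinear q'" "q' \<le> q" "\<And>e. e \<in> E \<Longrightarrow> q' (- e) \<le> - r"
proof -
  define h where "h x = (\<lambda>(l, e). q (x + l *\<^sub>R e) - l * r)" for x
  let ?I = "{0::real..} \<times> E"
  define q' where "q' x = (INF i\<in>?I. h x i)" for x
  have ne: "?I \<noteq> {}" using E by auto
  have sub: "q (x + y) \<le> q x + q y" for x y
    using q by (simp add: sublinear_def)
  have lower: "- q (- x) \<le> h x i" if "i \<in> ?I" for x i
  proof -
    obtain l e where i: "i = (l, e)" "l \<ge> 0" "e \<in> E" using \<open>i \<in> ?I\<close> by auto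
    have "l * r \<le> q (l *\<^sub>R e)"
      using i r[of e] sublinear_scale[OF q] by (simp add: mult_left_mono)
    also have "\<dots> \<le> q (x + l *\<^sub>R e) + q (- x)"
      using sub[of "x + l *\<^sub>R e" "- x"] by simp
    finally show ?thesis by (simp add: h_def i)
  qed
  have bdd: "bdd_below (h x ` ?I)" for x
    using lower by (rule bdd_belowI2)
  have q'_le: "q' x \<le> h x i" if "i \<in> ?I" for x i
    unfolding q'_def by (rule cINF_lower[OF bdd that])
  have q'_greatest: "m \<le> q' x" if "\<And>i. i \<in> ?I \<Longrightarrow> m \<le> h x i" for x m
    unfolding q'_def by (rule cINF_greatest[OF ne that])
  have q'_le_q: "q' x \<le> q x" for x
  proof -
    obtain e where "e \<in> E" using E by auto
    then show ?thesis using q'_le[of "(0, e)" x] by (simp add: h_def)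
  qed
  have "sublinear q'"
    unfolding sublinear_def
  proof (intro conjI allI impI)
    have "q 0 = 0" using q by (simp add: sublinear_def)
    then have "0 \<le> q' 0" using q'_greatest[of 0 0] lower[of _ 0] by simp
    then show "q' 0 = 0" using q'_le_q[of 0] \<open>q 0 = 0\<close> by simp
  next
    fix x y
    \<comment> \<open>Two competitors for x and y combine into one for the sum, at a convex combination g of their
      points of E.\<close>
    have key: "q' (x + y) \<le> h x i + h y j" if "i \<in> ?I" "j \<in> ?I" for i j
    proof -
      obtain l e where i: "i = (l, e)" "l \<ge> 0" "e \<in> E" using \<open>i \<in> ?I\<close> by auto
      obtain m f where j: "j = (m, f)" "m \<ge> 0" "f \<in> E" using \<open>j \<in> ?I\<close> by auto
      obtain g where g: "g \<in> E" "(l + m) *\<^sub>R g = l *\<^sub>R e + m *\<^sub>R f"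
      proof (cases "l + m = 0")
        case True
        then have "l = 0" "m = 0" using i j by auto
        then show ?thesis using that[of e] i by simp
      next
        case False
        then have pos: "l + m > 0" using i j by auto
        have "(l / (l + m)) *\<^sub>R e + (m / (l + m)) *\<^sub>R f \<in> E"
          using pos i j E by (intro convexD) (auto simp: add_divide_distrib[symmetric])
        moreover have "(l + m) *\<^sub>R ((l / (l + m)) *\<^sub>R e + (m / (l + m)) *\<^sub>R f) = l *\<^sub>R e + m *\<^sub>R f"
          using pos by (simp add: scaleR_add_right)
        ultimately show ?thesis using that by blast
      qed
      have "q' (x + y) \<le> h (x + y) (l + m, g)"
        using i j g by (intro q'_le) auto
      also have "\<dots> = q ((x + l *\<^sub>R e) + (y + m *\<^sub>R f)) - (l + m) * r"
        using g by (simp add: h_def algebra_simps)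
      also have "\<dots> \<le> q (x + l *\<^sub>R e) + q (y + m *\<^sub>R f) - (l + m) * r"
        using sub by simp
      also have "\<dots> = h x i + h y j" by (simp add: h_def i j algebra_simps)
      finally show ?thesis .
    qed
    have "q' (x + y) - q' x \<le> q' y"
    proof (rule q'_greatest)
      fix j assume j: "j \<in> ?I"
      have "q' (x + y) - h y j \<le> q' x"
        using key[OF _ j] by (intro q'_greatest) (simp add: diff_le_eq)
      then show "q' (x + y) - q' x \<le> h y j" by simp
    qed
    then show "q' (x + y) \<le> q' x + q' y" by simp
  next
    fix c :: real and x :: 'a
    assume c: "c > 0"
    have "q' (c *\<^sub>R x) / c \<le> q' x"
    proof (rule q'_greatest)
      fix i assume "i \<in> ?I"
      then obtain l e where i: "i = (l, e)" "l \<ge> 0" "e \<in> E" by auto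
      have "q' (c *\<^sub>R x) \<le> h (c *\<^sub>R x) (c * l, e)"
        using i c by (intro q'_le) auto
      also have "\<dots> = q (c *\<^sub>R (x + l *\<^sub>R e)) - c * l * r"
        by (simp add: h_def scaleR_add_right)
      also have "\<dots> = c * h x i"
        using sublinear_scale[OF q, of c "x + l *\<^sub>R e"] c by (simp add: h_def i right_diff_distrib)
      finally show "q' (c *\<^sub>R x) / c \<le> h x i"
        using c by (simp add: field_simps)
    qed
    then show "q' (c *\<^sub>R x) \<le> c * q' x" using c by (simp add: field_simps)
  qed
  moreover have "q' (- e) \<le> - r" if "e \<in> E" for e
    using q'_le[of "(1, e)" "- e"] that q by (simp add: h_def sublinear_def)
  ultimately show thesis using that q'_le_q by (metis le_fun_def)
qed

text \<open>Zorn's lemma: a chain of sublinear functionals below \<open>p\<close> has its pointwise infimum as a lower bound,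
  and \<open>- p (- x)\<close> keeps that infimum finite.\<close>

lemma sublinear_minimal:
  fixes p :: "'a::real_vector \<Rightarrow> real"
  assumes p: "sublinear p"
  obtains m where "sublinear m" "m \<le> p" "\<And>q. sublinear q \<Longrightarrow> q \<le> m \<Longrightarrow> q = m"
proof -
  let ?A = "{q. sublinear q \<and> q \<le> p}"
  let ?R = "\<lambda>q r :: 'a \<Rightarrow> real. r \<le> q"
  have po: "partial_order_on ?A (relation_of ?R ?A)"
    by (rule partial_order_on_relation_ofI) auto
  have "\<exists>u\<in>?A. \<forall>a\<in>C. ?R a u" if C: "C \<in> Chains (relation_of ?R ?A)" for C
  proof (cases "C = {}")
    case True
    then show ?thesis using p by auto
  next
    case False
    have CA: "sublinear q" "q \<le> p" if "q \<in> C" for q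
      using C that unfolding Chains_def relation_of_def by auto
    have tot: "q \<le> r \<or> r \<le> q" if "q \<in> C" "r \<in> C" for q r
      using C that unfolding Chains_def relation_of_def by auto
    define u where "u x = (INF q\<in>C. q x)" for x
    have bdd: "bdd_below ((\<lambda>q. q x) ` C)" for x
    proof (rule bdd_belowI2)
      fix q assume q: "q \<in> C"
      then have "q (- x) \<le> p (- x)" using CA(2) by (simp add: le_fun_def)
      then show "- p (- x) \<le> q x" using sublinear_minus_le[OF CA(1)[OF q], of x] by simp
    qed
    have u_le: "u x \<le> q x" if "q \<in> C" for q x
      unfolding u_def by (rule cINF_lower[OF bdd that])
    have u_greatest: "m \<le> u x" if "\<And>q. q \<in> C \<Longrightarrow> m \<le> q x" for m x
      unfolding u_def by (rule cINF_greatest[OF False that])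
    have "sublinear u"
      unfolding sublinear_def
    proof (intro conjI allI impI)
      have "q 0 = 0" if "q \<in> C" for q using CA(1)[OF that] by (simp add: sublinear_def)
      then have "(\<lambda>q. q 0) ` C = (\<lambda>q. 0) ` C" by (rule image_cong[OF refl])
      also have "\<dots> = {0}" using False by auto
      finally have "(\<lambda>q. q 0) ` C = {0}" .
      then show "u 0 = 0" unfolding u_def by simp
    next
      fix x y
      have key: "u (x + y) \<le> q x + r y" if "q \<in> C" "r \<in> C" for q r
      proof -
        obtain s where s: "s \<in> C" "s \<le> q" "s \<le> r" using tot[OF \<open>q \<in> C\<close> \<open>r \<in> C\<close>] \<open>q \<in> C\<close> \<open>r \<in> C\<close> by blast
        have "u (x + y) \<le> s x + s y"
          using u_le[OF s(1), of "x + y"] CA(1)[OF s(1)] unfolding sublinear_def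
          by (meson order_trans)
        also have "\<dots> \<le> q x + r y" using s by (simp add: add_mono le_fun_def)
        finally show ?thesis .
      qed
      have "u (x + y) - u x \<le> u y"
      proof (rule u_greatest)
        fix r assume r: "r \<in> C"
        have "u (x + y) - r y \<le> u x"
          using key[OF _ r] by (intro u_greatest) (simp add: diff_le_eq)
        then show "u (x + y) - u x \<le> r y" by simp
      qed
      then show "u (x + y) \<le> u x + u y" by simp
    next
      fix c :: real and x :: 'a
      assume c: "c > 0"
      have "u (c *\<^sub>R x) / c \<le> u x"
      proof (rule u_greatest)
        fix q assume q: "q \<in> C"
        then show "u (c *\<^sub>R x) / c \<le> q x"
          using u_le[OF q, of "c *\<^sub>R x"] sublinear_scale[OF CA(1)[OF q], of c x] c
          by (simp add: field_simps)
      qed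
      then show "u (c *\<^sub>R x) \<le> c * u x" using c by (simp add: field_simps)
    qed
    moreover have "u \<le> p"
      using False u_le CA(2) by (meson ex_in_conv le_fun_def order_trans)
    ultimately show ?thesis using u_le by (auto simp: le_fun_def)
  qed
  then obtain m where "m \<in> ?A" "\<forall>a\<in>?A. ?R m a \<longrightarrow> a = m"
    using predicate_Zorn[OF po] by blast
  then show thesis using that[of m] by (auto intro: order_trans)
qed

text \<open>A minimal sublinear functional cannot be lowered in any direction \<open>y\<close>; this forces \<open>f (- y) = - f y\<close>,
  and an odd sublinear functional is linear.\<close>

theorem Hahn_Banach_sublinear:
  fixes p :: "'a::real_vector \<Rightarrow> real"
  assumes "sublinear p"
  obtains f where "linear f" "f \<le> p"
proof -
  obtain f where f: "sublinear f" "f \<le> p" and min: "\<And>q. sublinear q \<Longrightarrow> q \<le> f \<Longrightarrow> q = f"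
    using sublinear_minimal[OF assms] by blast
  have minus: "f (- y) = - f y" for y
  proof -
    obtain q where q: "sublinear q" "q \<le> f" "q (- y) \<le> - f y"
      using sublinear_lowering[of f "{y}" "f y"] f by auto
    then have "f (- y) \<le> - f y" using min by blast
    then show ?thesis using sublinear_minus_le[OF f(1), of "- y"] by simp
  qed
  have sub: "f (x + y) \<le> f x + f y" for x y
    using f by (simp add: sublinear_def)
  have "f (x + y) = f x + f y" for x y
    using sub[of x y] sub[of "x + y" "- y"] by (simp add: minus)
  moreover have "f (c *\<^sub>R x) = c *\<^sub>R f x" for c x
  proof (cases "c \<ge> 0")
    case False
    then have "f ((- c) *\<^sub>R (- x)) = - c * f (- x)"
      using sublinear_scale[OF f(1), of "- c" "- x"] by simp
    then show ?thesis by (simp add: minus)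
  qed (simp add: sublinear_scale[OF f(1)])
  ultimately have "linear f" by (rule linearI)
  then show thesis using that f by blast
qed

text \<open>Lowering the norm by \<open>E = c - D\<close> and \<open>r\<close>, then dominating a linear functional by the result, yields
  a functional that stays below the norm and is at least \<open>r\<close> on \<open>c - D\<close>.\<close>

lemma separating_functional:
  fixes c :: "'a::real_normed_vector"
  assumes D: "convex D" "D \<noteq> {}" and r: "\<And>d. d \<in> D \<Longrightarrow> r \<le> dist c d"
  obtains f :: "'a \<Rightarrow>\<^sub>L real" where "norm f \<le> 1" "\<And>d. d \<in> D \<Longrightarrow> r \<le> f c - f d"
proof -
  have "sublinear (norm :: 'a \<Rightarrow> real)"
    by (simp add: sublinear_def norm_triangle_ineq)
  moreover have "convex ((\<lambda>d. c - d) ` D)"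
    using convex_translation[OF convex_negations[OF D(1)], of c] by (simp add: image_image)
  moreover have "r \<le> norm e" if "e \<in> (\<lambda>d. c - d) ` D" for e
    using that r by (auto simp: dist_norm)
  ultimately obtain q where q: "sublinear q" "q \<le> norm"
      and qD: "\<And>e. e \<in> (\<lambda>d. c - d) ` D \<Longrightarrow> q (- e) \<le> - r"
    using sublinear_lowering[of norm "(\<lambda>d. c - d) ` D" r] D(2) by auto
  obtain f where f: "linear f" "f \<le> q" using Hahn_Banach_sublinear[OF q(1)] .
  have le: "f x \<le> norm x" for x
    using le_funD[OF order_trans[OF f(2) q(2)], of x] .
  have "norm (f x) \<le> 1 * norm x" for x
    using le[of x] le[of "- x"] linear_neg[OF f(1), of x] by (simp add: abs_le_iff)
  then have bl: "bounded_linear f"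
    using f(1) by (intro bounded_linear.intro bounded_linear_axioms.intro exI[of _ 1]) auto
  show thesis
  proof (rule that[of "Blinfun f"])
    show "norm (Blinfun f) \<le> 1"
      using \<open>\<And>x. norm (f x) \<le> 1 * norm x\<close> bl
      by (intro norm_blinfun_bound) (auto simp: bounded_linear_Blinfun_apply)
    fix d assume "d \<in> D"
    then have "f (- (c - d)) \<le> - r"
      using qD[of "c - d"] le_funD[OF f(2), of "- (c - d)"] by fastforce
    then show "r \<le> Blinfun f c - Blinfun f d"
      using linear_neg[OF f(1), of "c - d"] linear_diff[OF f(1), of c d]
      by (simp only: bounded_linear_Blinfun_apply[OF bl])
  qed
qed

section \<open>Weak compactness and the support function embedding\<close>

lemma topspace_weak_topology: "topspace (weak_topology :: 'a::real_normed_vector topology) = UNIV"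
proof -
  have "UNIV \<in> {f -` U | (f :: 'a \<Rightarrow> real) U. bounded_linear f \<and> open U}"
    using bounded_linear_zero open_UNIV vimage_UNIV by blast
  then show ?thesis
    unfolding weak_topology_def topology_generated_by_topspace by blast
qed

lemma continuous_map_weak_functional:
  fixes f :: "'a::real_normed_vector \<Rightarrow> real"
  assumes "bounded_linear f"
  shows "continuous_map weak_topology euclidean f"
  unfolding continuous_map_alt
proof (intro conjI allI impI)
  fix U :: "real set" assume "openin euclidean U"
  then have "f -` U \<in> {f -` U | (f :: 'a \<Rightarrow> real) U. bounded_linear f \<and> open U}"
    using assms by auto
  then show "openin weak_topology (f -` U \<inter> topspace weak_topology)"
    unfolding topspace_weak_topology by (simp add: weak_topology_def topology_generated_by_Basis)
qed simp

lemma continuous_map_into_weak: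
  fixes T :: "'b \<Rightarrow> 'a::real_normed_vector"
  assumes "\<And>f :: 'a \<Rightarrow> real. bounded_linear f \<Longrightarrow> continuous_map X euclidean (\<lambda>x. f (T x))"
  shows "continuous_map X weak_topology T"
  unfolding weak_topology_def
proof (rule continuous_on_generated_topo)
  fix V assume "V \<in> {f -` U | (f :: 'a \<Rightarrow> real) U. bounded_linear f \<and> open U}"
  then obtain f :: "'a \<Rightarrow> real" and U where V: "V = f -` U" "bounded_linear f" "open U"
    by blast
  have "openin X {x \<in> topspace X. f (T x) \<in> U}"
    using assms[OF V(2)] V(3) by (intro openin_continuous_map_preimage[where Y = euclidean]) auto
  also have "{x \<in> topspace X. f (T x) \<in> U} = T -` V \<inter> topspace X"
    using V by auto
  finally show "openin X (T -` V \<inter> topspace X)" .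
next
  have "UNIV \<subseteq> \<Union>{f -` U | (f :: 'a \<Rightarrow> real) U. bounded_linear f \<and> open U}"
    using topspace_weak_topology[where 'a = 'a] unfolding weak_topology_def topology_generated_by_topspace
    by (rule equalityD2)
  then show "T ` topspace X \<subseteq> \<Union>{f -` U | (f :: 'a \<Rightarrow> real) U. bounded_linear f \<and> open U}" by blast
qed

lemma norm_attained_by_functional:
  fixes x :: "'a::real_normed_vector"
  obtains f :: "'a \<Rightarrow>\<^sub>L real" where "norm f \<le> 1" "norm x \<le> f x"
proof -
  obtain f :: "'a \<Rightarrow>\<^sub>L real" where "norm f \<le> 1" "\<And>d. d \<in> {0} \<Longrightarrow> norm x \<le> f x - f d"
    using separating_functional[of "{0::'a}" "norm x" x] by auto
  then show thesis using that[of f] by (simp add: blinfun.zero_right)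
qed

text \<open>The uniform boundedness principle for the evaluations at points of \<open>C\<close>, which act on the complete dual:
  by Baire one of the closed sets \<open>F n\<close> contains a ball. Since functionals in the unit ball attain the
  norm of a point, a bound on the dual ball is a bound on \<open>C\<close>.\<close>

lemma weakly_bounded_imp_bounded:
  fixes C :: "'a::real_normed_vector set"
  assumes "\<And>f :: 'a \<Rightarrow>\<^sub>L real. bounded (f ` C)"
  shows "bounded C"
proof -
  define F where "F n = {f :: 'a \<Rightarrow>\<^sub>L real. \<forall>x\<in>C. \<bar>f x\<bar> \<le> real n}" for n :: nat
  have closed: "closed (F n)" for n
  proof -
    have "F n = (\<Inter>x\<in>C. {f. \<bar>blinfun_apply f x\<bar> \<le> real n})" by (auto simp: F_def)
    moreover have "closed {f :: 'a \<Rightarrow>\<^sub>L real. \<bar>blinfun_apply f x\<bar> \<le> real n}" for x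
      by (intro closed_Collect_le continuous_intros)
    ultimately show ?thesis by auto
  qed
  have cover: "(\<Union>n. F n) = UNIV"
  proof (intro equalityI subsetI UNIV_I)
    fix f :: "'a \<Rightarrow>\<^sub>L real"
    obtain B where B: "\<And>x. x \<in> C \<Longrightarrow> \<bar>f x\<bar> \<le> B"
      using assms[of f] by (auto simp: bounded_iff)
    obtain n where "B \<le> real n" using real_arch_simple by blast
    then have "f \<in> F n" using B order_trans by (fastforce simp: F_def)
    then show "f \<in> (\<Union>n. F n)" by blast
  qed
  have "\<exists>n. interior (F n) \<noteq> {}"
  proof (rule ccontr)
    assume "\<not> ?thesis"
    then have "euclidean interior_of \<Union>(range F) = {}"
      using closed
      by (intro Baire_category_alt disjI1 completely_metrizable_space_euclidean) auto
    then show False unfolding cover by simp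
  qed
  then obtain n f0 where "f0 \<in> interior (F n)" by auto
  then obtain r where r: "r > 0" "cball f0 r \<subseteq> F n"
    by (meson interior_subset open_contains_cball open_interior subset_trans)
  have "norm x \<le> 2 * real n / r" if x: "x \<in> C" for x
  proof -
    obtain f :: "'a \<Rightarrow>\<^sub>L real" where f: "norm f \<le> 1" "norm x \<le> f x"
      using norm_attained_by_functional[of x] by blast
    have "f0 + r *\<^sub>R f \<in> F n" "f0 \<in> F n"
      using r f by (auto simp: dist_norm subset_iff)
    then have "\<bar>f0 x + r * f x\<bar> \<le> real n" "\<bar>f0 x\<bar> \<le> real n"
      using x by (auto simp: F_def blinfun.add_left blinfun.scaleR_left)
    then have "r * f x \<le> 2 * real n" by linarith
    then have "f x \<le> 2 * real n / r" using r by (simp add: field_simps)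
    then show ?thesis using f by simp
  qed
  then show ?thesis by (auto simp: bounded_iff)
qed

text \<open>The domain of the support function embedding: finite suprema require bounded and non-empty sets, and
  convexity makes the embedding an isometry.\<close>

definition bounded_convex :: "'a::real_normed_vector set set" where
  "bounded_convex = {C. C \<noteq> {} \<and> bounded C \<and> convex C}"

lemma cwk_bounded_convex: "C \<in> cwk \<Longrightarrow> C \<in> bounded_convex"
proof -
  assume C: "C \<in> cwk"
  have "bounded (f ` C)" for f :: "'a \<Rightarrow>\<^sub>L real"
  proof -
    have "continuous_map weak_topology euclidean (blinfun_apply f)"
      by (rule continuous_map_weak_functional) (rule blinfun.bounded_linear_right)
    moreover have "compactin weak_topology C" using C by (simp add: cwk_def)
    ultimately have "compactin euclidean (blinfun_apply f ` C)" by (rule image_compactin[rotated])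
    then have "compact (blinfun_apply f ` C)" by (simp only: compactin_euclidean_iff)
    then show ?thesis by (rule compact_imp_bounded)
  qed
  then show ?thesis
    using C weakly_bounded_imp_bounded by (auto simp: cwk_def bounded_convex_def)
qed

lemma cwk_scaleR:
  assumes "C \<in> cwk"
  shows "(*\<^sub>R) c ` C \<in> cwk"
proof -
  have "continuous_map weak_topology weak_topology ((*\<^sub>R) c :: 'a \<Rightarrow> 'a)"
  proof (rule continuous_map_into_weak)
    fix f :: "'a \<Rightarrow> real" assume "bounded_linear f"
    then have "bounded_linear (\<lambda>x. f (c *\<^sub>R x))"
      by (rule bounded_linear_compose) (rule bounded_linear_scaleR_right)
    then show "continuous_map weak_topology euclidean (\<lambda>x. f (c *\<^sub>R x))"
      by (rule continuous_map_weak_functional)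
  qed
  moreover have "compactin weak_topology C" using assms by (simp add: cwk_def)
  ultimately have "compactin weak_topology ((*\<^sub>R) c ` C)" by (rule image_compactin[rotated])
  then show ?thesis
    using assms by (simp add: cwk_def convex_scaling)
qed

lemma bounded_convex_plus:
  assumes "A \<in> bounded_convex" "B \<in> bounded_convex"
  shows "A + B \<in> bounded_convex"
proof -
  have "bounded (A + B)"
    using assms bounded_plus[of A B] by (simp add: bounded_convex_def set_plus_image)
  moreover have "A + B \<noteq> {}"
    using assms by (auto simp: bounded_convex_def set_plus_image)
  ultimately show ?thesis
    using assms by (simp add: bounded_convex_def convex_set_plus)
qed

lemma bounded_convex_scaleR:
  "A \<in> bounded_convex \<Longrightarrow> (*\<^sub>R) c ` A \<in> bounded_convex"
  by (auto simp: bounded_convex_def convex_scaling bounded_scaling)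

definition support :: "'a::real_normed_vector set \<Rightarrow> ('a \<Rightarrow>\<^sub>L real) \<Rightarrow> real" where
  "support C f = (SUP x\<in>C. f x)"

lemma support_bdd:
  fixes f :: "'a::real_normed_vector \<Rightarrow>\<^sub>L real"
  assumes "C \<in> bounded_convex"
  shows "bdd_above (blinfun_apply f ` C)"
proof -
  have "bounded (blinfun_apply f ` C)"
    using assms bounded_linear_image[OF _ blinfun.bounded_linear_right, of C f]
    by (simp add: bounded_convex_def)
  then show ?thesis by (rule bounded_imp_bdd_above)
qed

lemma support_upper: "C \<in> bounded_convex \<Longrightarrow> x \<in> C \<Longrightarrow> blinfun_apply f x \<le> support C f"
  unfolding support_def by (rule cSUP_upper[OF _ support_bdd])

lemma support_least: "C \<in> bounded_convex \<Longrightarrow> (\<And>x. x \<in> C \<Longrightarrow> blinfun_apply f x \<le> m) \<Longrightarrow> support C f \<le> m"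
  unfolding support_def bounded_convex_def by (rule cSUP_least) auto

lemma support_plus:
  assumes A: "A \<in> bounded_convex" and B: "B \<in> bounded_convex"
  shows "support (A + B) f = support A f + support B f"
proof (rule antisym)
  show "support (A + B) f \<le> support A f + support B f"
  proof (rule support_least[OF bounded_convex_plus[OF A B]])
    fix x assume "x \<in> A + B"
    then obtain a b where "x = a + b" "a \<in> A" "b \<in> B" by (rule set_plus_elim)
    then show "f x \<le> support A f + support B f"
      using support_upper[OF A, of a f] support_upper[OF B, of b f] by (simp add: blinfun.add_right)
  qed
  have "support A f \<le> support (A + B) f - support B f"
  proof (rule support_least[OF A])
    fix a assume a: "a \<in> A"
    have "support B f \<le> support (A + B) f - f a"
    proof (rule support_least[OF B])
      fix b assume "b \<in> B"
      then show "f b \<le> support (A + B) f - f a"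
        using support_upper[OF bounded_convex_plus[OF A B] set_plus_intro[OF a], of b f]
        by (simp add: blinfun.add_right)
    qed
    then show "f a \<le> support (A + B) f - support B f" by simp
  qed
  then show "support A f + support B f \<le> support (A + B) f" by simp
qed

lemma support_scaleR:
  assumes A: "A \<in> bounded_convex" and c: "c \<ge> 0"
  shows "support ((*\<^sub>R) c ` A) f = c * support A f"
proof (cases "c = 0")
  case True
  moreover from A have "(\<lambda>x. c *\<^sub>R x) ` A = {0}"
    using True by (auto simp: bounded_convex_def)
  ultimately show ?thesis by (simp add: support_def blinfun.zero_right)
next
  case False
  then have c: "c > 0" using c by simp
  have S: "(*\<^sub>R) c ` A \<in> bounded_convex" by (rule bounded_convex_scaleR[OF A])
  show ?thesis
  proof (rule antisym)
    show "support ((*\<^sub>R) c ` A) f \<le> c * support A f"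
      using support_upper[OF A, of _ f] c
      by (intro support_least[OF S]) (auto simp: blinfun.scaleR_right)
    have "support A f \<le> support ((*\<^sub>R) c ` A) f / c"
    proof (rule support_least[OF A])
      fix a assume "a \<in> A"
      then show "f a \<le> support ((*\<^sub>R) c ` A) f / c"
        using support_upper[OF S, of "c *\<^sub>R a" f] c by (simp add: blinfun.scaleR_right field_simps)
    qed
    then show "c * support A f \<le> support ((*\<^sub>R) c ` A) f" using c by (simp add: field_simps)
  qed
qed

text \<open>A continuous retraction of the dual onto its unit ball. Composing with it makes support functions
  bounded on a whole type, so that they form elements of the type of bounded continuous functions.\<close>

definition dual_retraction :: "('a::real_normed_vector \<Rightarrow>\<^sub>L real) \<Rightarrow> ('a \<Rightarrow>\<^sub>L real)" where
  "dual_retraction f = f /\<^sub>R max 1 (norm f)"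

lemma norm_dual_retraction: "norm (dual_retraction f) \<le> 1"
  by (simp add: dual_retraction_def divide_inverse[symmetric] field_simps)

lemma dual_retraction_id: "norm f \<le> 1 \<Longrightarrow> dual_retraction f = f"
  by (simp add: dual_retraction_def max_def)

definition support_map :: "'a::real_normed_vector set \<Rightarrow> ('a \<Rightarrow>\<^sub>L real) \<Rightarrow>\<^sub>C real" where
  "support_map C = Bcontfun (\<lambda>f. support C (dual_retraction f))"

lemma support_le_support:
  assumes C: "C \<in> bounded_convex" and M: "\<And>x. x \<in> C \<Longrightarrow> norm x \<le> M"
  shows "support C f \<le> support C g + M * norm (f - g)"
proof (rule support_least[OF C])
  fix x assume x: "x \<in> C"
  have "f x = g x + (f - g) x" by (simp add: blinfun.diff_left)
  also have "(f - g) x \<le> norm (f - g) * norm x"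
    using norm_blinfun[of "f - g" x] by simp
  also have "\<dots> \<le> M * norm (f - g)"
    using mult_right_mono[OF M[OF x], of "norm (f - g)"] by (simp add: mult.commute)
  finally show "f x \<le> support C g + M * norm (f - g)"
    using support_upper[OF C x, of g] by simp
qed

text \<open>A support function is Lipschitz with the norm bound of the set as its constant, hence continuous, and it is
  bounded on the unit ball.\<close>

lemma support_map_apply:
  assumes C: "C \<in> bounded_convex"
  shows "support_map C f = support C (dual_retraction f)"
proof -
  obtain M where M: "\<And>x. x \<in> C \<Longrightarrow> norm x \<le> M"
    using C by (auto simp: bounded_convex_def bounded_iff)
  have "C \<noteq> {}" using C by (simp add: bounded_convex_def)
  then have "M \<ge> 0" using M norm_ge_zero by (meson ex_in_conv order_trans)
  have lip: "dist (support C f) (support C g) \<le> M * dist f g" for f g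
    using support_le_support[OF C M, of f g] support_le_support[OF C M, of g f]
    by (auto simp: dist_norm norm_minus_commute abs_le_iff)
  have "continuous_on UNIV (support C)"
  proof (rule continuous_on_iff[THEN iffD2], intro ballI allI impI)
    fix f and e :: real assume e: "e > 0"
    show "\<exists>d>0. \<forall>g\<in>UNIV. dist g f < d \<longrightarrow> dist (support C g) (support C f) < e"
    proof (intro exI[of _ "e / (M + 1)"] conjI ballI impI)
      fix g assume "dist g f < e / (M + 1)"
      then have "(M + 1) * dist g f < e" using \<open>M \<ge> 0\<close> by (simp add: field_simps)
      moreover have "M * dist g f \<le> (M + 1) * dist g f" by (simp add: mult_right_mono)
      ultimately show "dist (support C g) (support C f) < e" using lip[of g f] by simp
    qed (use e \<open>M \<ge> 0\<close> in simp)
  qed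
  moreover have "continuous_on UNIV (dual_retraction :: ('a \<Rightarrow>\<^sub>L real) \<Rightarrow> _)"
    unfolding dual_retraction_def by (intro continuous_intros) auto
  ultimately have "continuous_on UNIV (\<lambda>f. support C (dual_retraction f))"
    by (rule continuous_on_compose2) simp
  moreover have "bounded (range (\<lambda>f. support C (dual_retraction f)))"
  proof (rule boundedI[of _ "M"], clarify)
    fix f
    have "dist (support C (dual_retraction f)) (support C 0) \<le> M * dist (dual_retraction f) 0"
      by (rule lip)
    also have "\<dots> \<le> M" using norm_dual_retraction[of f] \<open>M \<ge> 0\<close> by (simp add: mult_left_le)
    also have "support C 0 = 0" using \<open>C \<noteq> {}\<close> by (simp add: support_def)
    finally show "norm (support C (dual_retraction f)) \<le> M" by (simp add: dist_norm)
  qed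
  ultimately show ?thesis
    unfolding support_map_def by (simp add: Bcontfun_inverse bcontfun_def)
qed

lemma support_map_plus:
  assumes "A \<in> bounded_convex" "B \<in> bounded_convex"
  shows "support_map (A + B) = support_map A + support_map B"
  using assms by (intro bcontfun_eqI) (simp add: support_map_apply bounded_convex_plus support_plus)

lemma support_map_scaleR:
  assumes "A \<in> bounded_convex" "c \<ge> 0"
  shows "support_map ((*\<^sub>R) c ` A) = c *\<^sub>R support_map A"
  using assms by (intro bcontfun_eqI) (simp add: support_map_apply bounded_convex_scaleR support_scaleR)

lemma zero_bounded_convex: "0 \<in> bounded_convex"
  by (simp add: bounded_convex_def set_zero)

lemma bounded_convex_sum:
  assumes "\<And>i. i \<in> I \<Longrightarrow> C i \<in> bounded_convex"
  shows "(\<Sum>i\<in>I. C i) \<in> bounded_convex"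
  using assms by (induction I rule: infinite_finite_induct)
    (simp_all add: bounded_convex_plus zero_bounded_convex del: set_zero)

lemma support_map_sum:
  fixes C :: "'i \<Rightarrow> 'a::real_normed_vector set"
  assumes "\<And>i. i \<in> I \<Longrightarrow> C i \<in> bounded_convex"
  shows "support_map (\<Sum>i\<in>I. C i) = (\<Sum>i\<in>I. support_map (C i))"
proof -
  have z: "support_map (0 :: 'a set) = 0"
    using support_map_plus[of "0 :: 'a set" 0, OF zero_bounded_convex zero_bounded_convex] by (simp del: set_zero)
  show ?thesis
    using assms by (induction I rule: infinite_finite_induct)
      (simp_all add: z support_map_plus bounded_convex_sum del: set_zero)
qed

lemma norm_le_support_map:
  assumes C: "C \<in> bounded_convex" and x: "x \<in> C"
  shows "norm x \<le> norm (support_map C)"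
proof -
  obtain f :: "'a \<Rightarrow>\<^sub>L real" where f: "norm f \<le> 1" "norm x \<le> f x"
    using norm_attained_by_functional[of x] by blast
  have "norm x \<le> support C f" using f support_upper[OF C x, of f] by simp
  also have "\<dots> = support_map C f" by (simp add: support_map_apply[OF C] dual_retraction_id f)
  also have "\<dots> \<le> norm (support_map C)" using norm_bounded[of "support_map C" f] by simp
  finally show ?thesis .
qed

lemma infdist_le_hausdorff_dist:
  assumes A: "bounded A" "a \<in> A" and B: "B \<noteq> {}"
  shows "infdist a B \<le> hausdorff_dist A B" and "infdist a B \<le> hausdorff_dist B A"
proof -
  obtain b where b: "b \<in> B" using B by auto
  obtain M where M: "\<And>x. x \<in> A \<Longrightarrow> dist b x \<le> M" using A(1) bounded_any_center by metis
  have "bdd_above ((\<lambda>x. infdist x B) ` A)"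
    using infdist_le[OF b] M by (intro bdd_aboveI2[of _ _ M]) (metis dist_commute order_trans)
  then have "infdist a B \<le> (SUP x\<in>A. infdist x B)" using A(2) by (rule cSUP_upper[rotated])
  then show "infdist a B \<le> hausdorff_dist A B" "infdist a B \<le> hausdorff_dist B A"
    by (auto simp: hausdorff_dist_def)
qed

lemma hausdorff_dist_le:
  assumes "A \<noteq> {}" "B \<noteq> {}"
    and "\<And>a. a \<in> A \<Longrightarrow> infdist a B \<le> e" "\<And>b. b \<in> B \<Longrightarrow> infdist b A \<le> e"
  shows "hausdorff_dist A B \<le> e"
  unfolding hausdorff_dist_def using assms by (auto intro!: cSUP_least)

lemma infdist_le_dist_support_map:
  assumes A: "A \<in> bounded_convex" and B: "B \<in> bounded_convex" and a: "a \<in> A"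
  shows "infdist a B \<le> dist (support_map A) (support_map B)"
proof -
  have "convex B" "B \<noteq> {}" using B by (auto simp: bounded_convex_def)
  then obtain f :: "'a \<Rightarrow>\<^sub>L real" where f: "norm f \<le> 1" "\<And>b. b \<in> B \<Longrightarrow> infdist a B \<le> f a - f b"
    using separating_functional[of B "infdist a B" a] infdist_le by metis
  have "support B f \<le> f a - infdist a B"
    using f(2) by (intro support_least[OF B]) (simp add: algebra_simps le_diff_eq)
  then have "infdist a B \<le> support A f - support B f"
    using support_upper[OF A a, of f] by simp
  also have "\<dots> = support_map A f - support_map B f"
    by (simp add: support_map_apply A B dual_retraction_id f)
  also have "\<dots> \<le> dist (support_map A) (support_map B)"
    using dist_bounded[of "support_map A" f "support_map B"] by (simp add: dist_real_def)
  finally show ?thesis .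
qed

lemma support_le_hausdorff_dist:
  assumes A: "A \<in> bounded_convex" and B: "B \<in> bounded_convex" and f: "norm f \<le> 1"
    and h: "\<And>a. a \<in> A \<Longrightarrow> infdist a B \<le> h"
  shows "support A f \<le> support B f + h"
proof (rule support_least[OF A])
  have ne: "B \<noteq> {}" using B by (simp add: bounded_convex_def)
  fix a assume a: "a \<in> A"
  have "f a - support B f \<le> infdist a B"
    unfolding infdist_notempty[OF ne]
  proof (rule cINF_greatest[OF ne])
    fix b assume b: "b \<in> B"
    have "f a = f b + f (a - b)" by (simp add: blinfun.diff_right)
    also have "f (a - b) \<le> norm f * norm (a - b)" using norm_blinfun[of f "a - b"] by simp
    also have "\<dots> \<le> dist a b" using f by (simp add: dist_norm mult_left_le_one_le)
    finally show "f a - support B f \<le> dist a b" using support_upper[OF B b, of f] by simp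
  qed
  then show "f a \<le> support B f + h" using h[OF a] by simp
qed

text \<open>Hormander's formula. One direction is the separation of a point of one set from the other set, the
  other is the Lipschitz estimate for functionals of norm at most one.\<close>

theorem dist_support_map:
  assumes A: "A \<in> bounded_convex" and B: "B \<in> bounded_convex"
  shows "dist (support_map A) (support_map B) = hausdorff_dist A B"
proof (rule antisym)
  have ne: "A \<noteq> {}" "B \<noteq> {}" and bd: "bounded A" "bounded B"
    using A B by (auto simp: bounded_convex_def)
  show "hausdorff_dist A B \<le> dist (support_map A) (support_map B)"
    using infdist_le_dist_support_map[OF A B] infdist_le_dist_support_map[OF B A] ne
    by (intro hausdorff_dist_le) (auto simp: dist_commute)
  show "dist (support_map A) (support_map B) \<le> hausdorff_dist A B"
  proof (rule dist_bound)
    fix f :: "'a \<Rightarrow>\<^sub>L real"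
    have "support A (dual_retraction f) \<le> support B (dual_retraction f) + hausdorff_dist A B"
      using infdist_le_hausdorff_dist(1)[OF bd(1) _ ne(2)]
      by (rule support_le_hausdorff_dist[OF A B norm_dual_retraction])
    moreover have "support B (dual_retraction f) \<le> support A (dual_retraction f) + hausdorff_dist A B"
      using infdist_le_hausdorff_dist(2)[OF bd(2) _ ne(1)]
      by (rule support_le_hausdorff_dist[OF B A norm_dual_retraction])
    ultimately show "dist (support_map A f) (support_map B f) \<le> hausdorff_dist A B"
      by (simp add: support_map_apply A B dist_real_def abs_le_iff)
  qed
qed

section \<open>Series of weakly compact convex sets\<close>

text \<open>Completeness and the norm are both available for functions on a metric space; their combination makes
  Cauchy criteria for series applicable.\<close>

instance bcontfun :: (metric_space, banach) banach ..

text \<open>The sum is the set \<open>S\<close> of all sums \<open>\<Sum>n. y n\<close> of selections \<open>y n \<in> B n\<close>. The norm of a point is at most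
  that of the support function of its set, so the Cauchy criterion for the support functions is one for all
  selections simultaneously. On the product of the \<open>B n\<close>, compact for the product of the weak topologies, the
  sum is therefore weakly continuous as a uniform limit of finite sums, and \<open>S\<close> is weakly compact as the image.\<close>

theorem cwk_series:
  fixes B :: "nat \<Rightarrow> 'a::banach set"
  assumes B: "\<And>n. B n \<in> cwk" and summ: "summable (\<lambda>n. support_map (B n))"
  obtains S where "cwk_sums B S" "support_map S = (\<Sum>n. support_map (B n))"
proof -
  define Y where "Y = Pi\<^sub>E UNIV B"
  have Bbc: "B n \<in> bounded_convex" for n by (rule cwk_bounded_convex[OF B])
  have Y: "y \<in> Y \<longleftrightarrow> (\<forall>n. y n \<in> B n)" for y by (auto simp: Y_def PiE_iff)
  have block: "norm (sum y I) \<le> norm (\<Sum>n\<in>I. support_map (B n))" if y: "y \<in> Y" and I: "finite I" for y I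
  proof -
    have "sum y I \<in> sum B I" using y I by (auto simp: set_sum_alt Y)
    then have "norm (sum y I) \<le> norm (support_map (sum B I))"
      by (rule norm_le_support_map[OF bounded_convex_sum[OF Bbc]])
    then show ?thesis by (simp add: support_map_sum Bbc)
  qed
  have Cauchy: "\<exists>N. \<forall>y\<in>Y. \<forall>m\<ge>N. \<forall>n. norm (sum y {m..<n}) < e" if "e > 0" for e
  proof -
    obtain N where "\<forall>m\<ge>N. \<forall>n. norm (\<Sum>k=m..<n. support_map (B k)) < e"
      using summ \<open>e > 0\<close> unfolding summable_Cauchy by blast
    then show ?thesis using block by (meson finite_atLeastLessThan le_less_trans)
  qed
  have summable_Y: "summable y" if "y \<in> Y" for y
    unfolding summable_Cauchy using Cauchy that by meson
  define T where "T y = suminf y" for y :: "nat \<Rightarrow> 'a"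
  have T_sums: "y sums T y" if "y \<in> Y" for y
    unfolding T_def using summable_Y[OF that] by (rule summable_sums)
  have uniform: "\<exists>N. \<forall>y\<in>Y. \<forall>m\<ge>N. norm (T y - sum y {..<m}) \<le> e" if "e > 0" for e
  proof -
    obtain N where N: "\<And>y m n. y \<in> Y \<Longrightarrow> m \<ge> N \<Longrightarrow> norm (sum y {m..<n}) < e"
      using Cauchy[OF \<open>e > 0\<close>] by blast
    have "norm (T y - sum y {..<m}) \<le> e" if "y \<in> Y" "m \<ge> N" for y m
    proof (rule Lim_norm_ubound)
      show "(\<lambda>n. sum y {..<n} - sum y {..<m}) \<longlonglongrightarrow> T y - sum y {..<m}"
        using T_sums[OF \<open>y \<in> Y\<close>] unfolding sums_def by (intro tendsto_intros)
      show "\<forall>\<^sub>F n in sequentially. norm (sum y {..<n} - sum y {..<m}) \<le> e"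
      proof (rule eventually_sequentiallyI[of m])
        fix n assume "m \<le> n"
        then have "sum y {..<n} - sum y {..<m} = sum y {m..<n}"
          by (simp add: atLeast0LessThan[symmetric] sum_diff_nat_ivl)
        then show "norm (sum y {..<n} - sum y {..<m}) \<le> e"
          using N[OF that] by (simp add: less_imp_le)
      qed
    qed simp
    then show ?thesis by blast
  qed
  define S where "S = T ` Y"
  obtain y0 where y0: "\<And>n. y0 n \<in> B n"
  proof -
    have "\<exists>y. y \<in> B n" for n using B[of n] by (auto simp: cwk_def)
    then show ?thesis using that by metis
  qed
  have "S \<noteq> {}" using y0 Y[of y0] by (auto simp: S_def)
  moreover have "convex S"
  proof (rule convexI)
    fix a b u v assume "a \<in> S" "b \<in> S" and uv: "0 \<le> u" "0 \<le> v" "u + v = (1::real)"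
    then obtain y z where yz: "y \<in> Y" "a = T y" "z \<in> Y" "b = T z" by (auto simp: S_def)
    have "(\<lambda>n. u *\<^sub>R y n + v *\<^sub>R z n) \<in> Y"
      using yz uv Bbc by (auto simp: Y bounded_convex_def intro!: convexD)
    moreover have "(\<lambda>n. u *\<^sub>R y n + v *\<^sub>R z n) sums (u *\<^sub>R a + v *\<^sub>R b)"
      using T_sums yz by (intro sums_add sums_scaleR_right) auto
    then have "u *\<^sub>R a + v *\<^sub>R b = T (\<lambda>n. u *\<^sub>R y n + v *\<^sub>R z n)"
      unfolding T_def by (rule sums_unique)
    ultimately show "u *\<^sub>R a + v *\<^sub>R b \<in> S"
      unfolding S_def by (simp only: imageI)
  qed
  moreover have "compactin weak_topology S"
  proof -
    let ?P = "product_topology (\<lambda>n::nat. weak_topology :: 'a topology) UNIV"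
    have comp: "compactin ?P Y"
      unfolding Y_def compactin_PiE using B by (auto simp: cwk_def)
    have "continuous_map (subtopology ?P Y) weak_topology T"
    proof (rule continuous_map_into_weak)
      fix f :: "'a \<Rightarrow> real" assume f: "bounded_linear f"
      then obtain K where K: "K > 0" "\<And>x. norm (f x) \<le> norm x * K"
        using bounded_linear.pos_bounded by blast
      have "continuous_map (subtopology ?P Y) Met_TC.mtopology (\<lambda>y. f (T y))"
      proof (rule Met_TC.continuous_map_uniform_limit[where F = sequentially and f = "\<lambda>m y. \<Sum>n<m. f (y n)"])
        have "continuous_map ?P euclidean (\<lambda>y. f (y n))" for n
        proof -
          have "continuous_map ?P weak_topology (\<lambda>y. y n)"
            by (rule continuous_map_product_projection) simp
          then show ?thesis
            using continuous_map_compose[OF _ continuous_map_weak_functional[OF f]] by (fastforce simp: o_def)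
        qed
        then have "continuous_map (subtopology ?P Y) euclidean (\<lambda>y. \<Sum>n<m. f (y n))" for m
          by (intro continuous_map_sum continuous_map_from_subtopology) auto
        then show "\<forall>\<^sub>F m in sequentially. continuous_map (subtopology ?P Y) Met_TC.mtopology (\<lambda>y. \<Sum>n<m. f (y n))"
          by simp
        fix e :: real assume "e > 0"
        then obtain N where N: "\<And>y m. y \<in> Y \<Longrightarrow> m \<ge> N \<Longrightarrow> norm (T y - sum y {..<m}) \<le> e / (2 * K)"
          using uniform[of "e / (2 * K)"] K by auto
        have "dist (\<Sum>n<m. f (y n)) (f (T y)) < e" if "y \<in> Y" "m \<ge> N" for y m
        proof -
          have "(\<Sum>n<m. f (y n)) = f (sum y {..<m})"
            using f by (simp add: linear_sum bounded_linear.linear)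
          then have "dist (\<Sum>n<m. f (y n)) (f (T y)) = norm (f (T y - sum y {..<m}))"
            using f by (simp add: dist_norm norm_minus_commute linear_diff bounded_linear.linear)
          also have "\<dots> \<le> norm (T y - sum y {..<m}) * K" by (rule K)
          also have "\<dots> \<le> e / (2 * K) * K" using N[OF that] K by (intro mult_right_mono) auto
          also have "\<dots> < e" using K \<open>e > 0\<close> by simp
          finally show ?thesis .
        qed
        then show "\<forall>\<^sub>F m in sequentially. \<forall>y\<in>topspace (subtopology ?P Y). f (T y) \<in> UNIV \<and> dist (\<Sum>n<m. f (y n)) (f (T y)) < e"
          by (intro eventually_sequentiallyI[of N]) simp
      qed simp
      then show "continuous_map (subtopology ?P Y) euclidean (\<lambda>y. f (T y))" by simp
    qed
    moreover have "compactin (subtopology ?P Y) Y"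
      using comp by (simp add: compactin_subtopology)
    ultimately show ?thesis unfolding S_def by (rule image_compactin[rotated])
  qed
  ultimately have S: "S \<in> cwk" by (simp add: cwk_def)
  have partial: "\<exists>N. \<forall>m\<ge>N. hausdorff_dist (sum B {..<m}) S \<le> e" if "e > 0" for e
  proof -
    obtain N where N: "\<And>y m. y \<in> Y \<Longrightarrow> m \<ge> N \<Longrightarrow> norm (T y - sum y {..<m}) \<le> e"
      using uniform[OF \<open>e > 0\<close>] by blast
    have "hausdorff_dist (sum B {..<m}) S \<le> e" if m: "m \<ge> N" for m
    proof (rule hausdorff_dist_le)
      show "S \<noteq> {}" by fact
      show "sum B {..<m} \<noteq> {}" using bounded_convex_sum[OF Bbc, where I = "{..<m}"] by (simp add: bounded_convex_def)
    next
      fix a assume "a \<in> sum B {..<m}"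
      then obtain s where s: "a = sum s {..<m}" "\<forall>n<m. s n \<in> B n" by (auto simp: set_sum_alt)
      define y where "y n = (if n < m then s n else y0 n)" for n
      have y: "y \<in> Y" using s y0 by (simp add: Y y_def)
      have "a = sum y {..<m}" by (simp add: s y_def)
      then have "dist a (T y) \<le> e" using N[OF y m] by (simp add: dist_norm norm_minus_commute)
      moreover have "infdist a S \<le> dist a (T y)" using y by (intro infdist_le) (simp add: S_def)
      ultimately show "infdist a S \<le> e" by simp
    next
      fix b assume "b \<in> S"
      then obtain y where y: "y \<in> Y" "b = T y" by (auto simp: S_def)
      then have "sum y {..<m} \<in> sum B {..<m}" by (auto simp: set_sum_alt Y)
      then have "infdist b (sum B {..<m}) \<le> dist b (sum y {..<m})" by (rule infdist_le)
      then show "infdist b (sum B {..<m}) \<le> e" using N[OF y(1) m] y by (simp add: dist_norm)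
    qed
    then show ?thesis by blast
  qed
  have dist_eq: "hausdorff_dist (sum B {..<m}) S = dist (\<Sum>n<m. support_map (B n)) (support_map S)" for m
    by (simp add: support_map_sum[symmetric] dist_support_map Bbc bounded_convex_sum cwk_bounded_convex[OF S])
  have "(\<lambda>m. \<Sum>n<m. support_map (B n)) \<longlonglongrightarrow> support_map S"
  proof (rule metric_LIMSEQ_I)
    fix e :: real assume "e > 0"
    then obtain N where "\<forall>m\<ge>N. hausdorff_dist (sum B {..<m}) S \<le> e / 2"
      using partial[of "e / 2"] by auto
    then show "\<exists>N. \<forall>m\<ge>N. dist (\<Sum>n<m. support_map (B n)) (support_map S) < e"
      using \<open>e > 0\<close> unfolding dist_eq by force
  qed
  moreover from this have "(\<lambda>m. hausdorff_dist (sum B {..<m}) S) \<longlonglongrightarrow> 0"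
    unfolding dist_eq by (rule tendsto_dist_iff[THEN iffD1])
  ultimately show thesis
    using that[of S] S by (simp add: cwk_sums_def sums_def[symmetric] sums_unique)
qed

section \<open>Differentiability of variational primitives\<close>

text \<open>The variational integral in terms of a point function: \<open>F (Sup I) - F (Inf I)\<close> is the increment of the
  interval function over \<open>I\<close>, so additivity over divisions holds by telescoping.\<close>

definition variational_primitive :: "(real \<Rightarrow> 'b::real_normed_vector) \<Rightarrow> (real \<Rightarrow> 'b) \<Rightarrow> bool" where
  "variational_primitive F g \<longleftrightarrow>
     (\<forall>e>0. \<exists>\<delta>. (\<forall>t. \<delta> t > 0) \<and>
        (\<forall>P. P tagged_division_of {0..1} \<and> (\<lambda>t. ball t (\<delta> t)) fine P \<longrightarrow>
           (\<Sum>(t, I)\<in>P. norm (F (Sup I) - F (Inf I) - measure lebesgue I *\<^sub>R g t)) < e))"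

lemma tagged_partial_division_extend:
  fixes Q :: "(real \<times> real set) set"
  assumes Q: "Q tagged_partial_division_of cbox a b" and d: "gauge d" "d fine Q"
  obtains P where "P tagged_division_of cbox a b" "d fine P" "Q \<subseteq> P"
proof -
  have divQ: "snd ` Q division_of \<Union>(snd ` Q)"
    by (rule partial_division_of_tagged_division[OF Q])
  have "\<Union>(snd ` Q) \<subseteq> cbox a b"
    using tagged_partial_division_ofD(3)[OF Q] by fastforce
  then obtain q where q: "snd ` Q \<subseteq> q" "q division_of cbox a b"
    using partial_division_extend_interval[OF divQ] by blast
  define R where "R = Q \<union> (\<lambda>K. (Inf K, K)) ` (q - snd ` Q)"
  have R_q: "snd ` R = q" using q(1) by (auto simp: R_def image_Un image_image)
  have tags: "x \<in> K" if "(x, K) \<in> R" for x K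
  proof (cases "(x, K) \<in> Q")
    case True
    then show ?thesis using Q unfolding tagged_partial_division_of_def by auto
  next
    case False
    then have K: "K \<in> q" "x = Inf K" using that by (auto simp: R_def)
    then obtain u v where "K = cbox u v" "K \<noteq> {}" using division_ofD(3,4)[OF q(2)] by metis
    then show ?thesis using K by auto
  qed
  have disj: "interior K1 \<inter> interior K2 = {}"
    if "(x1, K1) \<in> R" "(x2, K2) \<in> R" "(x1, K1) \<noteq> (x2, K2)" for x1 K1 x2 K2
  proof (cases "K1 = K2")
    case False
    have "K1 \<in> q" "K2 \<in> q" using that(1,2) unfolding R_q[symmetric] by force+
    then show ?thesis using False by (rule division_ofD(5)[OF q(2)])
  next
    case True
    then have "(x1, K1) \<in> Q \<and> (x2, K2) \<in> Q" using that by (auto simp: R_def rev_image_eqI)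
    then show ?thesis using tagged_partial_division_ofD(5)[OF Q] that(3) by blast
  qed
  have "R tagged_division_of cbox a b"
    unfolding tagged_division_of_def tagged_partial_division_of_def
  proof (intro conjI allI impI)
    have "finite Q" using Q unfolding tagged_partial_division_of_def by auto
    then show "finite R" using division_ofD(1)[OF q(2)] by (simp add: R_def)
    have "{K. \<exists>x. (x, K) \<in> R} = q" unfolding R_q[symmetric] by force
    then show "\<Union>{K. \<exists>x. (x, K) \<in> R} = cbox a b" using division_ofD(6)[OF q(2)] by simp
  next
    fix x K assume "(x, K) \<in> R"
    then have K: "K \<in> q" unfolding R_q[symmetric] by force
    show "K \<subseteq> cbox a b" "\<exists>u v. K = cbox u v"
      using division_ofD(2,4)[OF q(2) K] by blast+
  qed (use tags disj in blast)+
  then obtain P where P: "P tagged_division_of cbox a b" "d fine P"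
      "\<forall>(x, K)\<in>R. K \<subseteq> d x \<longrightarrow> (x, K) \<in> P"
    using tagged_division_finer[OF _ d(1)] by blast
  have "Q \<subseteq> P"
  proof (rule subrelI)
    fix x K assume "(x, K) \<in> Q"
    moreover from this have "K \<subseteq> d x" by (rule fineD[OF d(2)])
    moreover have "(x, K) \<in> R" using \<open>(x, K) \<in> Q\<close> by (simp add: R_def)
    ultimately show "(x, K) \<in> P" using P(3) by blast
  qed
  then show thesis using that P by blast
qed

text \<open>In the variational setting Henstock's lemma is immediate: all terms are nonnegative, so a sum over
  part of a division is bounded by the sum over an extension.\<close>

lemma variational_partial:
  fixes g :: "real \<Rightarrow> 'b::real_normed_vector"
  assumes "\<forall>P. P tagged_division_of {0..1} \<and> (\<lambda>t. ball t (\<delta> t)) fine P \<longrightarrow>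
             (\<Sum>(t, I)\<in>P. norm (F (Sup I) - F (Inf I) - measure lebesgue I *\<^sub>R g t)) < e"
    and "\<forall>t. \<delta> t > 0"
    and Q: "Q tagged_partial_division_of {0..1}" "(\<lambda>t. ball t (\<delta> t)) fine Q"
  shows "(\<Sum>(t, I)\<in>Q. norm (F (Sup I) - F (Inf I) - measure lebesgue I *\<^sub>R g t)) < e"
proof -
  have "gauge (\<lambda>t. ball t (\<delta> t))" using assms(2) by (auto simp: gauge_def)
  then obtain P where P: "P tagged_division_of {0..1}" "(\<lambda>t. ball t (\<delta> t)) fine P" "Q \<subseteq> P"
    using tagged_partial_division_extend[of Q 0 1 "\<lambda>t. ball t (\<delta> t)"] Q by auto
  have "(\<Sum>(t, I)\<in>Q. norm (F (Sup I) - F (Inf I) - measure lebesgue I *\<^sub>R g t))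
      \<le> (\<Sum>(t, I)\<in>P. norm (F (Sup I) - F (Inf I) - measure lebesgue I *\<^sub>R g t))"
    using P by (intro sum_mono2) (auto simp: tagged_division_of_def tagged_partial_division_of_def)
  then show ?thesis using assms(1) P(1,2) by fastforce
qed

text \<open>The bad intervals at the points of the exceptional set form a Vitali cover. A finite disjoint
  family of them that is fine for the gauge of \<open>e \<eta>\<close> has total length at most \<open>e\<close>, since each of its intervals \<open>I\<close>
  contributes more than \<open>\<eta> |I|\<close> to a variational sum below \<open>e \<eta>\<close>.\<close>

lemma negligible_bad_quotients:
  assumes vp: "variational_primitive F g" and \<eta>: "\<eta> > 0"
  shows "negligible {t. \<forall>d>0. \<exists>a b. a < b \<and> t \<in> {a..b} \<and> {a..b} \<subseteq> {0..1} \<and> b - a < d \<and>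
           \<eta> * (b - a) < norm (F b - F a - (b - a) *\<^sub>R g t)}" (is "negligible ?E")
  unfolding negligible_outer_le
proof (intro allI impI)
  fix e :: real assume e: "e > 0"
  define bad where "bad t a b \<longleftrightarrow> a < b \<and> t \<in> {a..b} \<and> {a..b} \<subseteq> {0..1} \<and>
     \<eta> * (b - a) < norm (F b - F a - (b - a) *\<^sub>R g t)" for t a b
  obtain \<delta> where \<delta>: "\<forall>t. \<delta> t > 0"
    and var: "\<forall>P. P tagged_division_of {0..1} \<and> (\<lambda>t. ball t (\<delta> t)) fine P \<longrightarrow>
       (\<Sum>(t, I)\<in>P. norm (F (Sup I) - F (Inf I) - measure lebesgue I *\<^sub>R g t)) < e * \<eta>"
    using vp[unfolded variational_primitive_def, rule_format, OF mult_pos_pos[OF e \<eta>]] by blast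
  \<comment> \<open>The intervals carry their bad point along, as it will serve as their tag.\<close>
  define K where "K = {(t, a, b). bad t a b \<and> b - a < \<delta> t}"
  let ?c = "\<lambda>(t::real, a, b). (a + b) / 2 :: real" and ?r = "\<lambda>(t::real, a, b). (b - a) / 2 :: real"
  have cb: "cball (?c i) (?r i) = {fst (snd i)..snd (snd i)}" for i
    by (cases i) (simp add: cball_eq_atLeastAtMost field_simps)
  obtain C where C: "countable C" "C \<subseteq> K"
      "pairwise (\<lambda>i j. disjnt (cball (?c i) (?r i)) (cball (?c j) (?r j))) C"
      "negligible (?E - (\<Union>i\<in>C. cball (?c i) (?r i)))"
  proof (rule Vitali_covering_theorem_cballs[of K ?r ?E ?c])
    fix i assume "i \<in> K"
    then show "0 < ?r i" by (auto simp: K_def bad_def)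
  next
    fix t d :: real assume t: "t \<in> ?E" "0 < d"
    have "0 < min d (\<delta> t)" using t(2) \<delta> by simp
    then obtain a b where "bad t a b" "b - a < min d (\<delta> t)"
      using t(1) unfolding bad_def by blast
    then show "\<exists>i. i \<in> K \<and> t \<in> cball (?c i) (?r i) \<and> ?r i < d"
      unfolding cb by (intro exI[of _ "(t, a, b)"]) (auto simp: K_def bad_def)
  qed
  let ?U = "\<Union>i\<in>C. cball (?c i) (?r i)"
  have fin: "measure lebesgue (\<Union>i\<in>D. cball (?c i) (?r i)) \<le> e" if D: "D \<subseteq> C" "finite D" for D
  proof -
    define f where "f = (\<lambda>(t::real, a::real, b). (t, {a..b}))"
    have DK: "bad t a b" "b - a < \<delta> t" if "(t, a, b) \<in> D" for t a b
      using that D C by (auto simp: K_def)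
    have lt: "a < b" if "(t, a, b) \<in> D" for t a b
      using DK(1)[OF that] by (simp add: bad_def)
    have disj: "{a..b} \<inter> {a'..b'} = {}"
      if "(t, a, b) \<in> D" "(t', a', b') \<in> D" "(t, a, b) \<noteq> (t', a', b')" for t a b t' a' b'
    proof -
      have "(t, a, b) \<in> C" "(t', a', b') \<in> C" using that D by auto
      then have "disjnt (cball (?c (t, a, b)) (?r (t, a, b))) (cball (?c (t', a', b')) (?r (t', a', b')))"
        using that(3) by (rule pairwiseD[OF C(3)])
      then show ?thesis unfolding cb by (simp add: disjnt_def)
    qed
    have inj: "inj_on f D"
    proof (rule inj_onI)
      fix i j assume ij: "i \<in> D" "j \<in> D" "f i = f j"
      obtain t a b t' a' b' where i: "i = (t, a, b)" and j: "j = (t', a', b')"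
        by (metis prod_cases3)
      note * = ij[unfolded i j]
      have "a < b" using DK(1)[OF *(1)] by (simp add: bad_def)
      then have "{a..b} \<inter> {a'..b'} \<noteq> {}" using *(3) by (auto simp: f_def)
      then show "i = j" unfolding i j using disj *(1,2) by blast
    qed
    have "f ` D tagged_partial_division_of {0..1}"
      unfolding tagged_partial_division_of_def
    proof (intro conjI allI impI)
      fix x1 K1 x2 K2 assume *: "(x1, K1) \<in> f ` D \<and> (x2, K2) \<in> f ` D \<and> (x1, K1) \<noteq> (x2, K2)"
      then obtain a1 b1 a2 b2 where "(x1, a1, b1) \<in> D" "K1 = {a1..b1}" "(x2, a2, b2) \<in> D" "K2 = {a2..b2}"
        by (auto simp: f_def)
      moreover from this have "(x1, a1, b1) \<noteq> (x2, a2, b2)" using * by auto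
      ultimately have "K1 \<inter> K2 = {}" using disj by blast
      then show "interior K1 \<inter> interior K2 = {}" using interior_subset by blast
    next
      fix x K assume "(x, K) \<in> f ` D"
      then obtain a b where D: "(x, a, b) \<in> D" "K = {a..b}" by (auto simp: f_def)
      show "x \<in> K" "K \<subseteq> {0..1}" using DK(1)[OF D(1)] D(2) unfolding bad_def by blast+
      show "\<exists>u v. K = cbox u v" using D(2) by auto
    qed (simp add: D)
    moreover have "(\<lambda>t. ball t (\<delta> t)) fine f ` D"
    proof (rule fineI)
      fix x K assume "(x, K) \<in> f ` D"
      then obtain a b where D: "(x, a, b) \<in> D" "K = {a..b}" by (auto simp: f_def)
      then show "K \<subseteq> ball x (\<delta> x)"
        using DK[OF D(1)] by (auto simp: bad_def dist_real_def)
    qed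
    ultimately have "(\<Sum>(t, I)\<in>f ` D. norm (F (Sup I) - F (Inf I) - measure lebesgue I *\<^sub>R g t)) < e * \<eta>"
      by (rule variational_partial[OF var \<delta>])
    moreover have "(\<Sum>(t, I)\<in>f ` D. norm (F (Sup I) - F (Inf I) - measure lebesgue I *\<^sub>R g t))
        = (\<Sum>(t, a, b)\<in>D. norm (F b - F a - (b - a) *\<^sub>R g t))"
      unfolding sum.reindex[OF inj] by (intro sum.cong) (auto simp: f_def dest: lt)
    moreover have "(\<Sum>(t, a, b)\<in>D. \<eta> * (b - a)) \<le> (\<Sum>(t, a, b)\<in>D. norm (F b - F a - (b - a) *\<^sub>R g t))"
      using DK(1) by (intro sum_mono) (auto simp: bad_def less_imp_le)
    moreover have "(\<Sum>(t, a, b)\<in>D. \<eta> * (b - a)) = \<eta> * (\<Sum>(t, a, b)\<in>D. b - a)"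
      by (simp add: sum_distrib_left case_prod_unfold)
    ultimately have "\<eta> * (\<Sum>(t, a, b)\<in>D. b - a) < \<eta> * e" by (simp add: mult.commute)
    then have le: "(\<Sum>(t, a, b)\<in>D. b - a) \<le> e" using \<eta> by simp
    have "measure lebesgue (\<Union>i\<in>D. cball (?c i) (?r i)) \<le> (\<Sum>i\<in>D. measure lebesgue (cball (?c i) (?r i)))"
      using D(2) by (intro measure_UNION_le) auto
    also have "\<dots> = (\<Sum>(t, a, b)\<in>D. b - a)"
      unfolding cb by (intro sum.cong) (auto dest: lt)
    finally show ?thesis using le by simp
  qed
  have U: "?U \<in> lmeasurable" "measure lebesgue ?U \<le> e"
    using fmeasurable_UN_bound[OF C(1) _ fin] measure_UN_bound[OF C(1) _ fin] by auto
  have "?E \<subseteq> (?E - ?U) \<union> ?U" by blast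
  moreover have "(?E - ?U) \<union> ?U \<in> lmeasurable"
    using U(1) C(4) by (intro fmeasurable.Un) (simp_all add: negligible_iff_measure)
  moreover have "measure lebesgue ((?E - ?U) \<union> ?U) \<le> e"
  proof -
    have "measure lebesgue ((?E - ?U) \<union> ?U) \<le> measure lebesgue (?E - ?U) + measure lebesgue ?U"
      using U(1) C(4) by (intro measure_Un_le) (auto simp: negligible_iff_measure)
    then show ?thesis using U(2) C(4) by (simp add: negligible_iff_measure)
  qed
  ultimately show "\<exists>T. ?E \<subseteq> T \<and> T \<in> lmeasurable \<and> measure lebesgue T \<le> e" by blast
qed

lemma variational_primitive_differentiable_AE:
  assumes vp: "variational_primitive F g"
  obtains N where "negligible N"
    "\<And>t \<eta>. t \<notin> N \<Longrightarrow> \<eta> > 0 \<Longrightarrow> \<exists>d>0. \<forall>a b. a < b \<and> t \<in> {a..b} \<and> {a..b} \<subseteq> {0..1} \<and> b - a < d \<longrightarrow>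
        norm (F b - F a - (b - a) *\<^sub>R g t) \<le> \<eta> * (b - a)"
proof -
  define E where "E \<eta> = {t. \<forall>d>0. \<exists>a b. a < b \<and> t \<in> {a..b} \<and> {a..b} \<subseteq> {0..1} \<and> b - a < d \<and>
           \<eta> * (b - a) < norm (F b - F a - (b - a) *\<^sub>R g t)}" for \<eta> :: real
  let ?N = "\<Union>n. E (1 / real (Suc n))"
  have "negligible ?N"
    unfolding E_def by (intro negligible_Union_nat negligible_bad_quotients[OF vp]) simp
  moreover have "\<exists>d>0. \<forall>a b. a < b \<and> t \<in> {a..b} \<and> {a..b} \<subseteq> {0..1} \<and> b - a < d \<longrightarrow>
        norm (F b - F a - (b - a) *\<^sub>R g t) \<le> \<eta> * (b - a)" if t: "t \<notin> ?N" and \<eta>: "\<eta> > 0" for t \<eta>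
  proof -
    obtain n where n: "1 / real (Suc n) < \<eta>" using \<eta> nat_approx_posE by blast
    have "t \<notin> E (1 / real (Suc n))" using t by blast
    then obtain d where d: "d > 0" "\<And>a b. a < b \<Longrightarrow> t \<in> {a..b} \<Longrightarrow> {a..b} \<subseteq> {0..1} \<Longrightarrow> b - a < d \<Longrightarrow>
        norm (F b - F a - (b - a) *\<^sub>R g t) \<le> 1 / real (Suc n) * (b - a)"
      unfolding E_def mem_Collect_eq by (meson not_le)
    have "norm (F b - F a - (b - a) *\<^sub>R g t) \<le> \<eta> * (b - a)"
      if "a < b \<and> t \<in> {a..b} \<and> {a..b} \<subseteq> {0..1} \<and> b - a < d" for a b
    proof -
      have "norm (F b - F a - (b - a) *\<^sub>R g t) \<le> 1 / real (Suc n) * (b - a)"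
        using that by (intro d(2)) auto
      also have "\<dots> \<le> \<eta> * (b - a)" using n that by (intro mult_right_mono) auto
      finally show ?thesis .
    qed
    then show ?thesis using d(1) by blast
  qed
  ultimately show thesis by (rule that)
qed

section \<open>Partitions into pieces of small oscillation\<close>

text \<open>On the cell of length \<open>1 / (n + 1)\<close> that contains \<open>t\<close>, the difference quotient \<open>D n k\<close> of \<open>F\<close> tends to
  \<open>g t\<close> for almost every \<open>t\<close>. So \<open>g\<close> is measurable as a limit of step functions, and almost all of its values, in a space that may be
  far from separable, are approximated by the countably many quotients.\<close>

lemma variational_primitive_measurable:
  fixes g :: "real \<Rightarrow> 'b::real_normed_vector"
  assumes vp: "variational_primitive F g"
  obtains N and D :: "nat \<Rightarrow> int \<Rightarrow> 'b" where "negligible N" "(\<lambda>t. if t \<in> {0..<1} - N then g t else 0) \<in> borel_measurable lebesgue"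
    "\<forall>t\<in>{0..<1} - N. \<forall>e>0. \<exists>n k. dist (g t) (D n k) < e"
proof -
  obtain N where N: "negligible N"
    and diff: "\<And>t \<eta>. t \<notin> N \<Longrightarrow> \<eta> > 0 \<Longrightarrow> \<exists>d>0. \<forall>a b. a < b \<and> t \<in> {a..b} \<and> {a..b} \<subseteq> {0..1} \<and> b - a < d \<longrightarrow>
        norm (F b - F a - (b - a) *\<^sub>R g t) \<le> \<eta> * (b - a)"
    using variational_primitive_differentiable_AE[OF vp] by metis
  define D where "D n k = real (Suc n) *\<^sub>R (F (real_of_int (k + 1) / real (Suc n)) - F (real_of_int k / real (Suc n)))" for n k
  have lim: "(\<lambda>n. D n \<lfloor>real (Suc n) * t\<rfloor>) \<longlonglongrightarrow> g t" if t: "t \<in> {0..<1} - N" for t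
  proof (rule LIMSEQ_I)
    fix e :: real assume "e > 0"
    then obtain d where d: "d > 0" "\<And>a b. a < b \<Longrightarrow> t \<in> {a..b} \<Longrightarrow> {a..b} \<subseteq> {0..1} \<Longrightarrow> b - a < d \<Longrightarrow>
        norm (F b - F a - (b - a) *\<^sub>R g t) \<le> e / 2 * (b - a)"
      using diff[of t "e / 2"] t by auto
    obtain n0 where n0: "1 / real (Suc n0) < d" using d(1) nat_approx_posE by blast
    have "norm (D n \<lfloor>real (Suc n) * t\<rfloor> - g t) < e" if n: "n \<ge> n0" for n
    proof -
      let ?m = "real (Suc n)"
      define k where "k = \<lfloor>?m * t\<rfloor>"
      define a b where "a = real_of_int k / ?m" and "b = real_of_int (k + 1) / ?m"
      have m: "?m > 0" by simp
      have k: "real_of_int k \<le> ?m * t" "?m * t < real_of_int (k + 1)"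
        unfolding k_def by linarith+
      have "?m * t < ?m" using t by simp
      then have "k < int (Suc n)" unfolding k_def by (simp add: floor_less_iff)
      then have k1: "real_of_int (k + 1) \<le> ?m" by linarith
      have "0 \<le> ?m * t" using t by simp
      then have k0: "0 \<le> k" unfolding k_def by simp
      have ba: "b - a = 1 / ?m" unfolding a_def b_def by (simp add: diff_divide_distrib[symmetric])
      have "b - a > 0" unfolding ba by simp
      then have ab: "a < b" by simp
      have tab: "t \<in> {a..b}" using k m unfolding a_def b_def
        by (simp add: pos_divide_le_eq pos_le_divide_eq mult.commute)
      have "0 \<le> a" using k0 unfolding a_def by simp
      moreover have "b \<le> 1" using k1 m unfolding b_def by (simp only: pos_divide_le_eq mult_1)
      ultimately have sub: "{a..b} \<subseteq> {0..1}" by auto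
      have "1 / ?m \<le> 1 / real (Suc n0)" using n by (simp add: field_simps)
      then have "b - a < d" using n0 ba by simp
      then have "norm (F b - F a - (b - a) *\<^sub>R g t) \<le> e / 2 * (b - a)"
        using ab tab sub by (intro d(2))
      then have *: "?m * norm (F b - F a - (1 / ?m) *\<^sub>R g t) \<le> e / 2"
        unfolding ba using m by (simp add: field_simps del: of_nat_Suc)
      have "D n k - g t = ?m *\<^sub>R (F b - F a - (1 / ?m) *\<^sub>R g t)"
        unfolding D_def a_def[symmetric] b_def[symmetric] using m
        by (simp add: scaleR_diff_right del: of_nat_Suc)
      then have "norm (D n k - g t) = ?m * norm (F b - F a - (1 / ?m) *\<^sub>R g t)"
        using m by (simp del: of_nat_Suc)
      then show ?thesis using * \<open>e > 0\<close> unfolding k_def by linarith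
    qed
    then show "\<exists>n0. \<forall>n\<ge>n0. norm (D n \<lfloor>real (Suc n) * t\<rfloor> - g t) < e" by blast
  qed
  have Nset: "N \<in> sets lebesgue" using N by (simp add: negligible_imp_sets)
  have "(\<lambda>t. if t \<in> {0..<1} - N then g t else 0) \<in> borel_measurable lebesgue"
  proof (rule borel_measurable_LIMSEQ_metric)
    fix n :: nat
    have "(\<lambda>t::real. \<lfloor>real (Suc n) * t\<rfloor>) \<in> measurable borel (count_space UNIV)" by measurable
    then have "(\<lambda>t::real. D n \<lfloor>real (Suc n) * t\<rfloor>) \<in> measurable borel borel"
      by (rule measurable_compose) simp
    then have "(\<lambda>t::real. D n \<lfloor>real (Suc n) * t\<rfloor>) \<in> borel_measurable lebesgue"
      by (simp add: measurable_completion)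
    then show "(\<lambda>t. if t \<in> {0..<1} - N then D n \<lfloor>real (Suc n) * t\<rfloor> else 0) \<in> borel_measurable lebesgue"
      using Nset by (intro measurable_If_set) auto
  next
    fix t :: real
    show "(\<lambda>n. if t \<in> {0..<1} - N then D n \<lfloor>real (Suc n) * t\<rfloor> else 0)
        \<longlonglongrightarrow> (if t \<in> {0..<1} - N then g t else 0)"
      using lim[of t] by (cases "t \<in> {0..<1} - N") (simp_all only: if_True if_False tendsto_const)
  qed
  moreover have "\<exists>n k. dist (g t) (D n k) < e" if t: "t \<in> {0..<1} - N" and e: "e > 0" for t e
  proof -
    have "eventually (\<lambda>n. dist (D n \<lfloor>real (Suc n) * t\<rfloor>) (g t) < e) sequentially"
      using lim[OF t] e by (rule tendstoD)
    then obtain n where "dist (D n \<lfloor>real (Suc n) * t\<rfloor>) (g t) < e"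
      unfolding eventually_sequentially by blast
    then show ?thesis by (metis dist_commute)
  qed
  ultimately show thesis using that N by blast
qed

text \<open>Preimages of small balls about the countably many approximating values cover \<open>[0,1]\<close> up to a
  null set, which is cut along the size of \<open>g\<close> so that \<open>g\<close> is bounded on every piece.\<close>

lemma small_oscillation_partition:
  fixes g :: "real \<Rightarrow> 'b::real_normed_vector"
  assumes vp: "variational_primitive F g" and e: "e > 0"
  obtains B :: "nat \<Rightarrow> real set" where "range B \<subseteq> sets lebesgue" "disjoint_family B" "(\<Union>n. B n) = {0..1}"
    "\<And>n. \<exists>M. \<forall>t\<in>B n. norm (g t) \<le> M"
    "\<And>n. negligible (B n) \<or> (\<forall>s\<in>B n. \<forall>t\<in>B n. dist (g s) (g t) \<le> e)"
proof -
  obtain N and D :: "nat \<Rightarrow> int \<Rightarrow> 'b" where N: "negligible N"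
    and meas: "(\<lambda>t. if t \<in> {0..<1} - N then g t else 0) \<in> borel_measurable lebesgue"
    and D: "\<forall>t\<in>{0..<1} - N. \<forall>e>0. \<exists>n k. dist (g t) (D n k) < e"
    by (rule variational_primitive_measurable[OF vp])
  have Nset: "N \<in> sets lebesgue" using N by (simp add: negligible_imp_sets)
  define U where "U c = {t \<in> {0..<1} - N. dist (g t) c < e / 2}" for c
  have U: "U c \<in> sets lebesgue" for c
  proof -
    have "(\<lambda>t. if t \<in> {0..<1} - N then g t else 0) -` ball c (e / 2) \<inter> space lebesgue \<in> sets lebesgue"
      using meas by (rule measurable_sets) simp
    then have "((\<lambda>t. if t \<in> {0..<1} - N then g t else 0) -` ball c (e / 2) \<inter> space lebesgue) \<inter> ({0..<1} - N) \<in> sets lebesgue"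
      using Nset by (intro sets.Int sets.Diff) auto
    also have "((\<lambda>t. if t \<in> {0..<1} - N then g t else 0) -` ball c (e / 2) \<inter> space lebesgue) \<inter> ({0..<1} - N) = U c"
      by (auto simp: U_def dist_commute)
    finally show ?thesis .
  qed
  define V where "V j = {t \<in> (N \<inter> {0..1}) \<union> {1}. norm (g t) \<le> real j}" for j :: nat
  have V: "negligible (V j)" for j
  proof (rule negligible_subset)
    show "negligible ((N \<inter> {0..1}) \<union> {1})" using N by (auto intro: negligible_Int negligible_Un)
  qed (auto simp: V_def)
  \<comment> \<open>Even indices list the null pieces, odd ones the preimages of balls.\<close>
  define W where "W m = (if even m then V (m div 2) else (case from_nat (m div 2) of (n :: nat, k :: int) \<Rightarrow> U (D n k)))" for m
  have W: "range W \<subseteq> sets lebesgue"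
    using U V by (auto simp: W_def negligible_imp_sets split: prod.split)
  have cover: "(\<Union>m. W m) = {0..1}"
  proof
    show "(\<Union>m. W m) \<subseteq> {0..1}" by (auto simp: W_def U_def V_def split: if_splits prod.splits)
    show "{0..1} \<subseteq> (\<Union>m. W m)"
    proof
      fix t :: real assume t: "t \<in> {0..1}"
      show "t \<in> (\<Union>m. W m)"
      proof (cases "t \<in> {0..<1} - N")
        case True
        then obtain n k where "dist (g t) (D n k) < e / 2" using D e half_gt_zero by metis
        then have "t \<in> W (2 * to_nat (n, k) + 1)" using True by (simp add: W_def U_def)
        then show ?thesis by blast
      next
        case False
        obtain j where "norm (g t) \<le> real j" using real_arch_simple by blast
        then have "t \<in> W (2 * j)" using False t by (auto simp: W_def V_def)
        then show ?thesis by blast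
      qed
    qed
  qed
  have sub: "disjointed W n \<subseteq> W n" for n by (rule disjointed_subset)
  show thesis
  proof (rule that[of "disjointed W"])
    show "range (disjointed W) \<subseteq> sets lebesgue" using W by (rule sets.range_disjointed_sets)
    show "disjoint_family (disjointed W)" by (rule disjoint_family_disjointed)
    show "(\<Union>n. disjointed W n) = {0..1}" by (simp only: UN_disjointed_eq cover)
    fix n
    show "\<exists>M. \<forall>t\<in>disjointed W n. norm (g t) \<le> M"
    proof (cases "even n")
      case True
      then have "disjointed W n \<subseteq> V (n div 2)" using sub[of n] by (simp add: W_def)
      then show ?thesis by (auto simp: V_def)
    next
      case False
      then obtain c where c: "disjointed W n \<subseteq> U c" using sub[of n] by (auto simp: W_def split: prod.splits)
      have "norm (g t) \<le> norm c + e / 2" if "t \<in> disjointed W n" for t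
      proof -
        have "dist (g t) c < e / 2" using c that by (auto simp: U_def)
        then show ?thesis using norm_triangle_sub[of "g t" c] by (simp add: dist_norm)
      qed
      then show ?thesis by blast
    qed
    show "negligible (disjointed W n) \<or> (\<forall>s\<in>disjointed W n. \<forall>t\<in>disjointed W n. dist (g s) (g t) \<le> e)"
    proof (cases "even n")
      case True
      then have "disjointed W n \<subseteq> V (n div 2)" using sub[of n] by (simp add: W_def)
      then show ?thesis using negligible_subset[OF V] by blast
    next
      case False
      then obtain c where c: "disjointed W n \<subseteq> U c" using sub[of n] by (auto simp: W_def split: prod.splits)
      have "dist (g s) (g t) \<le> e" if "s \<in> disjointed W n" "t \<in> disjointed W n" for s t
      proof -
        have "dist (g s) c < e / 2" "dist (g t) c < e / 2" using c that by (auto simp: U_def)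
        then show ?thesis using dist_triangle_half_r[of c "g s" e "g t"] by (simp add: dist_commute)
      qed
      then show ?thesis by blast
    qed
  qed
qed

section \<open>The masses of a positive function\<close>

text \<open>The coordinate functionals of a space of bounded functions are the model; only these properties
  of them enter the argument.\<close>

definition norming :: "('b::real_normed_vector \<Rightarrow> real) set \<Rightarrow> bool" where
  "norming \<Lambda> \<longleftrightarrow> (\<forall>L\<in>\<Lambda>. linear L \<and> (\<forall>x. \<bar>L x\<bar> \<le> norm x)) \<and>
     (\<forall>x r. (\<forall>L\<in>\<Lambda>. \<bar>L x\<bar> \<le> r) \<longrightarrow> norm x \<le> r)"

text \<open>The order enters through \<open>\<Lambda>\<close> alone: \<open>g\<close> is positive off the null set \<open>N\<close> in the sense that all these functionals are nonnegative on it.\<close>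

locale positive_variational =
  fixes F g :: "real \<Rightarrow> 'b::real_normed_vector" and \<Lambda> :: "('b \<Rightarrow> real) set" and N :: "real set"
  assumes variational: "variational_primitive F g"
    and norming: "norming \<Lambda>"
    and null: "negligible N"
    and pos: "L \<in> \<Lambda> \<Longrightarrow> t \<in> {0..1} - N \<Longrightarrow> 0 \<le> L (g t)"
begin

lemma linear_functional: "L \<in> \<Lambda> \<Longrightarrow> linear L"
  using norming by (simp add: norming_def)

lemma functional_le_norm: "L \<in> \<Lambda> \<Longrightarrow> \<bar>L x\<bar> \<le> norm x"
  using norming by (simp add: norming_def)

lemma norm_le_functionals: "(\<And>L. L \<in> \<Lambda> \<Longrightarrow> \<bar>L x\<bar> \<le> r) \<Longrightarrow> norm x \<le> r"
  using norming by (simp add: norming_def)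

text \<open>Cut off on \<open>N\<close>, the coordinate is nonnegative everywhere on the unit interval.\<close>

definition density :: "('b \<Rightarrow> real) \<Rightarrow> real \<Rightarrow> real" where
  "density L t = (if t \<in> N then 0 else L (g t))"

definition mass :: "('b \<Rightarrow> real) \<Rightarrow> real set \<Rightarrow> real" where
  "mass L A = (LINT t:A|lebesgue. density L t)"

lemma density_nonneg: "L \<in> \<Lambda> \<Longrightarrow> t \<in> {0..1} \<Longrightarrow> 0 \<le> density L t"
  using pos by (simp add: density_def)

lemma increment_le:
  assumes L: "L \<in> \<Lambda>" and P: "P tagged_division_of {0..1}"
    and var: "(\<Sum>(t, I)\<in>P. norm (F (Sup I) - F (Inf I) - measure lebesgue I *\<^sub>R g t)) < e"
  shows "\<bar>(\<Sum>(t, I)\<in>P. measure lebesgue I * L (g t)) - (L (F 1) - L (F 0))\<bar> < e"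
proof -
  have "L (F 1) - L (F 0) = (\<Sum>(t, I)\<in>P. L (F (Sup I)) - L (F (Inf I)))"
    using additive_tagged_division_1[of 0 1 P "\<lambda>x. L (F x)"] P by simp
  then have "(\<Sum>(t, I)\<in>P. measure lebesgue I * L (g t)) - (L (F 1) - L (F 0))
      = - (\<Sum>(t, I)\<in>P. L (F (Sup I) - F (Inf I) - measure lebesgue I *\<^sub>R g t))"
    using linear_functional[OF L]
    by (simp add: linear_diff linear_scale sum_subtractf case_prod_unfold)
  then have "\<bar>(\<Sum>(t, I)\<in>P. measure lebesgue I * L (g t)) - (L (F 1) - L (F 0))\<bar>
      = \<bar>\<Sum>(t, I)\<in>P. L (F (Sup I) - F (Inf I) - measure lebesgue I *\<^sub>R g t)\<bar>" by simp
  also have "\<dots> \<le> (\<Sum>(t, I)\<in>P. \<bar>L (F (Sup I) - F (Inf I) - measure lebesgue I *\<^sub>R g t)\<bar>)"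
    by (simp add: case_prod_unfold sum_abs)
  also have "\<dots> \<le> (\<Sum>(t, I)\<in>P. norm (F (Sup I) - F (Inf I) - measure lebesgue I *\<^sub>R g t))"
    using functional_le_norm[OF L] by (intro sum_mono) (simp add: case_prod_unfold)
  finally show ?thesis using var by simp
qed

text \<open>A functional of norm at most one maps the variational estimate to the defining estimate of the
  Henstock-Kurzweil integral.\<close>

lemma has_integral_functional:
  assumes L: "L \<in> \<Lambda>"
  shows "((\<lambda>t. L (g t)) has_integral (L (F 1) - L (F 0))) {0..1}"
proof -
  have "((\<lambda>t. L (g t)) has_integral (L (F 1) - L (F 0))) (cbox 0 1)"
    unfolding has_integral
  proof (intro allI impI)
    fix e :: real assume "e > 0"
    then obtain \<delta> where \<delta>: "\<forall>t. \<delta> t > 0"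
      and var: "\<forall>P. P tagged_division_of {0..1} \<and> (\<lambda>t. ball t (\<delta> t)) fine P \<longrightarrow>
         (\<Sum>(t, I)\<in>P. norm (F (Sup I) - F (Inf I) - measure lebesgue I *\<^sub>R g t)) < e"
      using variational unfolding variational_primitive_def by blast
    show "\<exists>\<gamma>. gauge \<gamma> \<and> (\<forall>P. P tagged_division_of cbox 0 1 \<and> \<gamma> fine P \<longrightarrow>
        norm ((\<Sum>(t, I)\<in>P. measure lborel I *\<^sub>R L (g t)) - (L (F 1) - L (F 0))) < e)"
    proof (intro exI[of _ "\<lambda>t. ball t (\<delta> t)"] conjI allI impI)
      show "gauge (\<lambda>t. ball t (\<delta> t))" using \<delta> by (simp add: gauge_def)
      fix P assume "P tagged_division_of cbox 0 1 \<and> (\<lambda>t. ball t (\<delta> t)) fine P"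
      then have P: "P tagged_division_of {0..1}" "(\<lambda>t. ball t (\<delta> t)) fine P" by auto
      have "(\<Sum>(t, I)\<in>P. measure lborel I *\<^sub>R L (g t)) = (\<Sum>(t, I)\<in>P. measure lebesgue I * L (g t))"
      proof (intro sum.cong refl, clarify)
        fix t I assume "(t, I) \<in> P"
        then obtain a b where "I = cbox a b" using tagged_division_ofD(4)[OF P(1)] by blast
        then show "measure lborel I *\<^sub>R L (g t) = measure lebesgue I * L (g t)" by simp
      qed
      then show "norm ((\<Sum>(t, I)\<in>P. measure lborel I *\<^sub>R L (g t)) - (L (F 1) - L (F 0))) < e"
        using increment_le[OF L P(1)] var P by simp
    qed
  qed
  then show ?thesis by simp
qed

lemma has_integral_density:
  assumes L: "L \<in> \<Lambda>"
  shows "(density L has_integral (L (F 1) - L (F 0))) {0..1}"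
  by (rule has_integral_spike[OF null _ has_integral_functional[OF L]]) (simp add: density_def)

lemma integrable_density:
  assumes L: "L \<in> \<Lambda>" and A: "A \<in> sets lebesgue" "A \<subseteq> {0..1}"
  shows "set_integrable lebesgue A (density L)"
proof -
  have "density L absolutely_integrable_on {0..1}"
    using has_integral_density[OF L] density_nonneg[OF L]
    by (intro nonnegative_absolutely_integrable_1) (auto simp: integrable_on_def)
  then show ?thesis using A by (rule set_integrable_subset)
qed

lemma mass_total: "L \<in> \<Lambda> \<Longrightarrow> mass L {0..1} = L (F 1) - L (F 0)"
  unfolding mass_def
  using set_lebesgue_integral_eq_integral(2)[OF integrable_density, of L "{0..1}"] has_integral_density[of L]
  by (simp add: integral_unique)

lemma mass_Un:
  assumes "L \<in> \<Lambda>" "A \<in> sets lebesgue" "A \<subseteq> {0..1}" "B \<in> sets lebesgue" "B \<subseteq> {0..1}" "A \<inter> B = {}"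
  shows "mass L (A \<union> B) = mass L A + mass L B"
  unfolding mass_def using assms by (intro set_integral_Un integrable_density)

lemma mass_nonneg:
  assumes "L \<in> \<Lambda>" "A \<subseteq> {0..1}"
  shows "0 \<le> mass L A"
  unfolding mass_def set_lebesgue_integral_def
proof (rule integral_nonneg_AE, rule AE_I2)
  fix t show "0 \<le> indicat_real A t *\<^sub>R density L t"
    using density_nonneg[OF assms(1), of t] assms(2) by (auto simp: indicator_def)
qed

lemma mass_mono:
  assumes "L \<in> \<Lambda>" "A \<in> sets lebesgue" "B \<in> sets lebesgue" "B \<subseteq> {0..1}" "A \<subseteq> B"
  shows "mass L A \<le> mass L B"
proof -
  have "mass L (A \<union> (B - A)) = mass L A + mass L (B - A)"
    using assms by (intro mass_Un) auto
  moreover have "A \<union> (B - A) = B" using assms by auto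
  moreover have "0 \<le> mass L (B - A)" using assms by (intro mass_nonneg) auto
  ultimately show ?thesis by simp
qed

lemma lmeasurable_unit: "A \<in> sets lebesgue \<Longrightarrow> A \<subseteq> {0..1::real} \<Longrightarrow> A \<in> lmeasurable"
  by (rule fmeasurableI2[OF lmeasurable_cbox[of 0 1]]) (simp_all only: box_real)

lemma
  assumes L: "L \<in> \<Lambda>" and A: "A \<in> sets lebesgue" "A \<subseteq> {0..1}"
  shows mass_le: "(\<And>t. t \<in> A - N \<Longrightarrow> L (g t) \<le> c) \<Longrightarrow> mass L A \<le> measure lebesgue A * c"
    and mass_ge: "(\<And>t. t \<in> A - N \<Longrightarrow> c \<le> L (g t)) \<Longrightarrow> measure lebesgue A * c \<le> mass L A"
proof -
  have fin: "emeasure lebesgue A < \<infinity>" using lmeasurable_unit[OF A] by (auto simp: fmeasurable_def)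
  have const: "(LINT t:A|lebesgue. c) = measure lebesgue A * c"
    using set_integral_const[of A lebesgue c] A fin by simp
  have int: "set_integrable lebesgue A (\<lambda>t. c)"
    unfolding set_integrable_def using A fin by (intro integrable_scaleR_left) simp
  have AE_N: "AE t in lebesgue. t \<notin> N"
    using null by (intro AE_not_in) (simp add: negligible_iff_null_sets)
  show "mass L A \<le> measure lebesgue A * c" if "\<And>t. t \<in> A - N \<Longrightarrow> L (g t) \<le> c"
    unfolding mass_def const[symmetric]
    using AE_N that by (intro set_integral_mono_AE integrable_density[OF L A] int) (auto simp: density_def elim!: eventually_mono)
  show "measure lebesgue A * c \<le> mass L A" if "\<And>t. t \<in> A - N \<Longrightarrow> c \<le> L (g t)"
    unfolding mass_def const[symmetric]
    using AE_N that by (intro set_integral_mono_AE integrable_density[OF L A] int) (auto simp: density_def elim!: eventually_mono)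
qed

lemma mass_negligible:
  assumes L: "L \<in> \<Lambda>" and A: "negligible A" "A \<subseteq> {0..1}"
  shows "mass L A = 0"
proof -
  have "A \<in> sets lebesgue" using A by (simp add: negligible_imp_sets)
  have "AE t in lebesgue. t \<notin> A" using A by (intro AE_not_in) (simp add: negligible_iff_null_sets)
  then have "AE t in lebesgue. indicat_real A t *\<^sub>R density L t = 0"
    by (rule eventually_mono) simp
  then show ?thesis unfolding mass_def set_lebesgue_integral_def by (rule integral_eq_zero_AE)
qed

text \<open>Off \<open>N\<close> the density on \<open>A\<close> is within \<open>e\<close> of \<open>L (g s)\<close>, because \<open>L\<close> has norm at most one; for
  negligible \<open>A\<close> both terms vanish.\<close>

lemma oscillation_mass:
  assumes L: "L \<in> \<Lambda>" and A: "A \<in> sets lebesgue" "A \<subseteq> {0..1}"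
    and osc: "negligible A \<or> (\<forall>t\<in>A. dist (g s) (g t) \<le> e)"
  shows "\<bar>measure lebesgue A * L (g s) - mass L A\<bar> \<le> e * measure lebesgue A"
proof (cases "negligible A")
  case True
  then show ?thesis using mass_negligible[OF L True A(2)] by (simp add: negligible_imp_measure0)
next
  case False
  have close: "\<bar>L (g s) - L (g t)\<bar> \<le> e" if "t \<in> A" for t
  proof -
    have "\<bar>L (g s) - L (g t)\<bar> \<le> norm (g s - g t)"
      using functional_le_norm[OF L, of "g s - g t"] by (simp add: linear_diff[OF linear_functional[OF L]])
    then show ?thesis using osc False that by (auto simp: dist_norm intro: order_trans)
  qed
  have "L (g t) \<le> L (g s) + e" "L (g s) - e \<le> L (g t)" if "t \<in> A - N" for t
    using close[of t] that by auto
  then have "mass L A \<le> measure lebesgue A * (L (g s) + e)" "measure lebesgue A * (L (g s) - e) \<le> mass L A"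
    using mass_le[OF L A] mass_ge[OF L A] by blast+
  then show ?thesis by (simp add: abs_le_iff algebra_simps)
qed

end

section \<open>Uniform absolute continuity of the masses\<close>

context positive_variational
begin

text \<open>One fine division serves all \<open>L\<close>. The gauge keeps an interval tagged in \<open>B k\<close> inside an open set \<open>U k\<close>
  that exceeds \<open>B k\<close> so little that, even after multiplication with the bound \<open>M k\<close> of \<open>g\<close> there, all
  excesses together amount to at most \<open>e / 3\<close>. The Riemann sum of the division is then at most the mass of the finitely many pieces \<open>B k\<close> that contain tags,
  plus \<open>e / 3\<close> for the oscillation and \<open>e / 3\<close> for the excess, while it is within \<open>e / 3\<close> of the total mass.\<close>

lemma mass_concentrated:
  assumes e: "e > 0"
  obtains H M where "H \<in> sets lebesgue" "H \<subseteq> {0..1}" "M \<ge> 0" "\<forall>t\<in>H. norm (g t) \<le> M"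
    "\<forall>L\<in>\<Lambda>. mass L ({0..1} - H) \<le> e"
proof -
  define e1 where "e1 = e / 3"
  have e1: "e1 > 0" using e by (simp add: e1_def)
  obtain B :: "nat \<Rightarrow> real set" where B: "range B \<subseteq> sets lebesgue" "disjoint_family B" "(\<Union>n. B n) = {0..1}"
    and bd: "\<And>n. \<exists>M. \<forall>t\<in>B n. norm (g t) \<le> M"
    and osc: "\<And>n. negligible (B n) \<or> (\<forall>s\<in>B n. \<forall>t\<in>B n. dist (g s) (g t) \<le> e1)"
    using small_oscillation_partition[OF variational e1] by metis
  have Bm: "B n \<in> sets lebesgue" and Bsub: "B n \<subseteq> {0..1}" for n using B by auto
  have "\<exists>M\<ge>0. \<forall>t\<in>B n. norm (g t) \<le> M" for n
  proof -
    obtain M where "\<forall>t\<in>B n. norm (g t) \<le> M" using bd by blast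
    then have "\<forall>t\<in>B n. norm (g t) \<le> max M 0" by auto
    then show ?thesis using max.cobounded2[of 0 M] by blast
  qed
  then obtain M where M0: "\<And>n. M n \<ge> 0" and M: "\<And>n t. t \<in> B n \<Longrightarrow> norm (g t) \<le> M n" by metis
  define \<eta> where "\<eta> n = e1 * (1 / 2) ^ Suc n / (1 + M n)" for n
  have \<eta>: "\<eta> n > 0" "M n * \<eta> n \<le> e1 * (1 / 2) ^ Suc n" for n
  proof -
    have "1 + M n > 0" using M0[of n] by simp
    then show "\<eta> n > 0" using e1 by (simp add: \<eta>_def)
    have "M n / (1 + M n) \<le> 1" using M0[of n] by (simp add: divide_le_eq_1)
    then have "M n / (1 + M n) * (e1 * (1 / 2) ^ Suc n) \<le> 1 * (e1 * (1 / 2) ^ Suc n)"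
      using e1 by (intro mult_right_mono) auto
    then show "M n * \<eta> n \<le> e1 * (1 / 2) ^ Suc n"
      by (simp only: \<eta>_def times_divide_eq_right times_divide_eq_left mult_1)
  qed
  have "\<exists>T. open T \<and> B n \<subseteq> T \<and> T - B n \<in> lmeasurable \<and> measure lebesgue (T - B n) \<le> \<eta> n" for n
  proof -
    obtain T where T: "open T" "B n \<subseteq> T" "T - B n \<in> lmeasurable" "emeasure lebesgue (T - B n) < ennreal (\<eta> n)"
      using sets_lebesgue_outer_open[OF Bm \<eta>(1)] by blast
    have "ennreal (measure lebesgue (T - B n)) < ennreal (\<eta> n)"
      using T(3,4) by (simp add: emeasure_eq_measure2)
    then have "measure lebesgue (T - B n) \<le> \<eta> n"
      by (simp add: ennreal_less_iff)
    then show ?thesis using T by blast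
  qed
  then obtain U where U: "\<And>n. open (U n)" "\<And>n. B n \<subseteq> U n" "\<And>n. U n - B n \<in> lmeasurable"
      "\<And>n. measure lebesgue (U n - B n) \<le> \<eta> n"
    by metis
  define idx where "idx t = (SOME n. t \<in> B n)" for t
  have idx: "t \<in> B (idx t)" if "t \<in> {0..1}" for t
  proof -
    have "\<exists>n. t \<in> B n" using that B(3) by blast
    then show ?thesis unfolding idx_def by (rule someI_ex)
  qed
  obtain \<delta> where \<delta>: "\<forall>t. \<delta> t > 0"
    and var: "\<forall>P. P tagged_division_of {0..1} \<and> (\<lambda>t. ball t (\<delta> t)) fine P \<longrightarrow>
       (\<Sum>(t, I)\<in>P. norm (F (Sup I) - F (Inf I) - measure lebesgue I *\<^sub>R g t)) < e1"
    using variational e1 unfolding variational_primitive_def by blast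
  define d where "d t = ball t (\<delta> t) \<inter> (if t \<in> {0..1} then U (idx t) else UNIV)" for t
  have "gauge d"
    unfolding gauge_def
  proof
    fix t
    have "t \<in> U (idx t)" if "t \<in> {0..1}" using idx[OF that] U(2) by blast
    then show "t \<in> d t \<and> open (d t)" using \<delta> U(1) by (simp add: d_def open_Int)
  qed
  then obtain P where P: "P tagged_division_of {0..1}" "d fine P"
    by (rule fine_division_exists_real)
  have finP: "finite P" using P(1) by (rule tagged_division_of_finite)
  have "(\<lambda>t. ball t (\<delta> t)) fine P"
    using P(2) by (auto simp: fine_def d_def)
  then have varP: "(\<Sum>(t, I)\<in>P. norm (F (Sup I) - F (Inf I) - measure lebesgue I *\<^sub>R g t)) < e1"
    using var P(1) by blast
  let ?k = "\<lambda>p::real \<times> real set. idx (fst p)"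
  have tag: "fst p \<in> {0..1}" "snd p \<subseteq> {0..1}" "snd p \<in> lmeasurable" "snd p \<subseteq> U (?k p)" if p: "p \<in> P" for p
  proof -
    obtain t K where tK: "p = (t, K)" by (cases p)
    obtain a b where K: "K = cbox a b" using tagged_division_ofD(4)[OF P(1)] p tK by blast
    have "t \<in> K" "K \<subseteq> {0..1}" using tagged_division_ofD(2,3)[OF P(1)] p tK by auto
    then have t: "t \<in> {0..1}" by blast
    then show "fst p \<in> {0..1}" "snd p \<subseteq> {0..1}" using tK \<open>K \<subseteq> {0..1}\<close> by auto
    show "snd p \<in> lmeasurable" using K tK by simp
    have "K \<subseteq> d t" using fineD[OF P(2)] p tK by blast
    then show "snd p \<subseteq> U (?k p)" using t tK by (auto simp: d_def)
  qed
  have tagB: "fst p \<in> B (?k p)" if "p \<in> P" for p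
    using idx tag(1)[OF that] by blast
  have overlap: "negligible (snd p \<inter> snd q)" if pq: "p \<in> P" "q \<in> P" "p \<noteq> q" for p q
  proof -
    obtain t K t' K' where tK: "p = (t, K)" "q = (t', K')" by (cases p, cases q)
    obtain a b c d where K: "K = cbox a b" "K' = cbox c d"
      using tagged_division_ofD(4)[OF P(1)] pq tK by metis
    have "interior K \<inter> interior K' = {}"
      using tagged_division_ofD(5)[OF P(1)] pq tK by blast
    then have "interior (K \<inter> K') = {}" by simp
    moreover have "convex (K \<inter> K')" unfolding K by (intro convex_Int convex_box)
    ultimately have "negligible (K \<inter> K')" by (simp only: negligible_convex_interior)
    then show ?thesis using tK by simp
  qed
  have overlap': "negligible (S \<inter> T)" if "p \<in> P" "q \<in> P" "p \<noteq> q" "S \<subseteq> snd p" "T \<subseteq> snd q" for p q S T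
    by (rule negligible_subset[OF overlap[OF that(1-3)]]) (use that in blast)
  define H where "H = (\<Union>k\<in>?k ` P. B k)"
  have Hm: "H \<in> sets lebesgue" "H \<subseteq> {0..1}"
    using finP Bm Bsub by (auto simp: H_def)
  have bound: "norm (g t) \<le> (\<Sum>k\<in>?k ` P. M k)" if "t \<in> H" for t
  proof -
    obtain k where k: "k \<in> ?k ` P" "t \<in> B k" using \<open>t \<in> H\<close> by (auto simp: H_def)
    have "norm (g t) \<le> M k" using M k by blast
    also have "\<dots> \<le> (\<Sum>k\<in>?k ` P. M k)" using k finP M0 by (intro member_le_sum) auto
    finally show ?thesis .
  qed
  have total: "(\<Sum>p\<in>P. measure lebesgue (snd p)) = 1"
  proof -
    have "(\<Sum>p\<in>P. measure lebesgue (snd p)) = measure lebesgue (\<Union>(snd ` P))"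
      using overlap tag(3)
      by (intro measure_negligible_finite_Union_image[symmetric] finP) (auto simp: pairwise_def)
    also have "\<Union>(snd ` P) = {0..1}" using tagged_division_ofD(6)[OF P(1)] by force
    finally show ?thesis by simp
  qed
  \<comment> \<open>The parts of the intervals outside of the piece of their tag, grouped by pieces.\<close>
  have excess: "(\<Sum>p\<in>P. measure lebesgue (snd p - B (?k p)) * M (?k p)) \<le> e1"
  proof -
    have "(\<Sum>p\<in>P. measure lebesgue (snd p - B (?k p)) * M (?k p))
        = (\<Sum>k\<in>?k ` P. \<Sum>p\<in>{p \<in> P. ?k p = k}. measure lebesgue (snd p - B (?k p)) * M (?k p))"
      by (rule sum.image_gen[OF finP])
    also have "\<dots> \<le> (\<Sum>k\<in>?k ` P. e1 * (1 / 2) ^ Suc k)"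
    proof (rule sum_mono)
      fix k assume "k \<in> ?k ` P"
      let ?P = "{p \<in> P. ?k p = k}"
      have meas: "snd p - B k \<in> lmeasurable" if "p \<in> ?P" for p
        using tag(3) Bm that by (intro fmeasurable_Diff) auto
      have "(\<Sum>p\<in>?P. measure lebesgue (snd p - B (?k p)) * M (?k p)) = M k * (\<Sum>p\<in>?P. measure lebesgue (snd p - B k))"
        by (simp add: sum_distrib_left mult.commute)
      also have "(\<Sum>p\<in>?P. measure lebesgue (snd p - B k)) = measure lebesgue (\<Union>p\<in>?P. snd p - B k)"
      proof (rule measure_negligible_finite_Union_image[symmetric])
        show "finite ?P" using finP by simp
        show "pairwise (\<lambda>p q. negligible ((snd p - B k) \<inter> (snd q - B k))) ?P"
          unfolding pairwise_def using overlap' by blast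
      qed (rule meas)
      also have "\<dots> \<le> measure lebesgue (U k - B k)"
      proof (rule measure_mono_fmeasurable)
        show "(\<Union>p\<in>?P. snd p - B k) \<subseteq> U k - B k" using tag(4) by blast
        show "(\<Union>p\<in>?P. snd p - B k) \<in> sets lebesgue"
          using meas finP by (intro sets.finite_UN) auto
      qed (rule U(3))
      also have "\<dots> \<le> \<eta> k" by (rule U(4))
      finally show "(\<Sum>p\<in>?P. measure lebesgue (snd p - B (?k p)) * M (?k p)) \<le> e1 * (1 / 2) ^ Suc k"
        using \<eta>(2)[of k] M0[of k] by (meson mult_left_mono order_trans)
    qed
    also have "\<dots> \<le> (\<Sum>k. e1 * (1 / 2) ^ Suc k)"
    proof (rule sum_le_suminf)
      show "summable (\<lambda>k. e1 * (1 / 2) ^ Suc k)"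
        using power_half_series by (intro summable_mult) (rule sums_summable)
    qed (use e1 finP in auto)
    also have "\<dots> = e1"
      using sums_mult[OF power_half_series, of e1] by (simp add: sums_iff)
    finally show ?thesis .
  qed
  have "mass L ({0..1} - H) \<le> e" if L: "L \<in> \<Lambda>" for L
  proof -
    \<comment> \<open>The part of the interval inside the piece of its tag is controlled by oscillation, the part outside by the bound M.\<close>
    have piece: "measure lebesgue (snd p) * L (g (fst p))
        \<le> mass L (snd p \<inter> B (?k p)) + e1 * measure lebesgue (snd p)
          + measure lebesgue (snd p - B (?k p)) * M (?k p)" if p: "p \<in> P" for p
    proof -
      let ?I = "snd p \<inter> B (?k p)" and ?D = "snd p - B (?k p)"
      have m: "?I \<in> sets lebesgue" "?I \<in> lmeasurable" "?D \<in> lmeasurable"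
        using tag(3)[OF p] Bm by (auto intro: fmeasurable_Diff fmeasurable_Int_fmeasurable)
      have "\<bar>measure lebesgue ?I * L (g (fst p)) - mass L ?I\<bar> \<le> e1 * measure lebesgue ?I"
      proof (rule oscillation_mass[OF L m(1)])
        show "?I \<subseteq> {0..1}" using tag(2)[OF p] by blast
        show "negligible ?I \<or> (\<forall>t\<in>?I. dist (g (fst p)) (g t) \<le> e1)"
          using osc[of "?k p"] tagB[OF p] by (auto intro: negligible_subset)
      qed
      then have "measure lebesgue ?I * L (g (fst p)) \<le> mass L ?I + e1 * measure lebesgue ?I"
        by (simp add: abs_le_iff)
      also have "measure lebesgue ?I \<le> measure lebesgue (snd p)"
        using m(1) tag(3)[OF p] by (intro measure_mono_fmeasurable) auto
      finally have 1: "measure lebesgue ?I * L (g (fst p)) \<le> mass L ?I + e1 * measure lebesgue (snd p)"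
        using e1 by simp
      have "L (g (fst p)) \<le> M (?k p)"
        using functional_le_norm[OF L, of "g (fst p)"] M[OF tagB[OF p]] by simp
      then have 2: "measure lebesgue ?D * L (g (fst p)) \<le> measure lebesgue ?D * M (?k p)"
        by (intro mult_left_mono) simp_all
      have "measure lebesgue (snd p) = measure lebesgue (?I \<union> ?D)" by (simp add: Int_Diff_Un)
      also have "\<dots> = measure lebesgue ?I + measure lebesgue (?D - ?I)"
        by (rule measure_Un2[OF m(2,3)])
      also have "?D - ?I = ?D" by blast
      finally show ?thesis using 1 2 by (simp add: distrib_right)
    qed
    have AE_disj: "AE x in lebesgue. x \<in> snd p \<inter> B (?k p) \<and> x \<in> snd q \<inter> B (?k q) \<longrightarrow> p = q"
      if "p \<in> P" "q \<in> P" for p q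
    proof (cases "p = q")
      case False
      then have "AE x in lebesgue. x \<notin> snd p \<inter> snd q"
        using overlap that by (intro AE_not_in) (simp add: negligible_iff_null_sets)
      then show ?thesis by (rule eventually_mono) blast
    qed simp
    have "(\<Sum>p\<in>P. mass L (snd p \<inter> B (?k p))) = mass L (\<Union>p\<in>P. snd p \<inter> B (?k p))"
      unfolding mass_def
      using finP AE_disj tag(2,3) Bm
      by (intro set_integral_finite_UN_AE[symmetric] integrable_density[OF L]) blast+
    also have "\<dots> \<le> mass L H"
      using tag(3) Bm finP by (intro mass_mono[OF L] Hm sets.finite_UN) (auto simp: H_def)
    finally have mH: "(\<Sum>p\<in>P. mass L (snd p \<inter> B (?k p))) \<le> mass L H" .
    have "L (F 1) - L (F 0) \<le> (\<Sum>(t, I)\<in>P. measure lebesgue I * L (g t)) + e1"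
      using increment_le[OF L P(1) varP] by linarith
    also have "(\<Sum>(t, I)\<in>P. measure lebesgue I * L (g t)) = (\<Sum>p\<in>P. measure lebesgue (snd p) * L (g (fst p)))"
      by (simp add: case_prod_unfold)
    also have "\<dots> \<le> (\<Sum>p\<in>P. mass L (snd p \<inter> B (?k p)) + e1 * measure lebesgue (snd p)
          + measure lebesgue (snd p - B (?k p)) * M (?k p))"
      by (rule sum_mono[OF piece])
    also have "\<dots> = (\<Sum>p\<in>P. mass L (snd p \<inter> B (?k p))) + e1 * (\<Sum>p\<in>P. measure lebesgue (snd p))
          + (\<Sum>p\<in>P. measure lebesgue (snd p - B (?k p)) * M (?k p))"
      by (simp add: sum.distrib sum_distrib_left)
    also have "\<dots> \<le> mass L H + e1 + e1" using mH excess total by simp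
    finally have le: "mass L {0..1} \<le> mass L H + e" by (simp add: mass_total[OF L] e1_def)
    have "mass L (H \<union> ({0..1} - H)) = mass L H + mass L ({0..1} - H)"
      using Hm by (intro mass_Un[OF L]) auto
    moreover have "H \<union> ({0..1} - H) = {0..1}" using Hm by auto
    ultimately show ?thesis using le by simp
  qed
  moreover have "0 \<le> (\<Sum>k\<in>?k ` P. M k)" using M0 by (simp add: sum_nonneg)
  ultimately show thesis using that[of H "\<Sum>k\<in>?k ` P. M k"] Hm bound by blast
qed

text \<open>Outside of the set \<open>H\<close> of concentration the masses are small altogether, and on \<open>H\<close> their densities have a common bound.\<close>

lemma mass_uniformly_continuous:
  assumes e: "e > 0"
  obtains \<delta> where "\<delta> > 0"
    "\<forall>L\<in>\<Lambda>. \<forall>A\<in>sets lebesgue. A \<subseteq> {0..1} \<and> measure lebesgue A < \<delta> \<longrightarrow> mass L A \<le> e"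
proof -
  obtain H M where H: "H \<in> sets lebesgue" "H \<subseteq> {0..1}" and M: "M \<ge> 0" "\<forall>t\<in>H. norm (g t) \<le> M"
    and rest: "\<forall>L\<in>\<Lambda>. mass L ({0..1} - H) \<le> e / 2"
    using e half_gt_zero by (metis mass_concentrated)
  show thesis
  proof (rule that[of "e / (2 * (M + 1))"], safe)
    show "0 < e / (2 * (M + 1))" using e M by simp
    fix L and A :: "real set" assume L: "L \<in> \<Lambda>" and A: "A \<in> sets lebesgue" "A \<subseteq> {0..1}" "measure lebesgue A < e / (2 * (M + 1))"
    have meas: "A \<inter> H \<in> sets lebesgue" "A - H \<in> sets lebesgue" using A H by auto
    have "mass L A = mass L ((A \<inter> H) \<union> (A - H))" by (simp add: Int_Diff_Un)
    also have "\<dots> = mass L (A \<inter> H) + mass L (A - H)"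
      using meas A by (intro mass_Un[OF L]) auto
    also have "mass L (A \<inter> H) \<le> measure lebesgue (A \<inter> H) * M"
    proof (rule mass_le[OF L meas(1)])
      fix t assume "t \<in> A \<inter> H - N"
      then show "L (g t) \<le> M" using functional_le_norm[OF L, of "g t"] M by force
    qed (use A in blast)
    also have "measure lebesgue (A \<inter> H) \<le> measure lebesgue A"
      using meas lmeasurable_unit[OF A(1,2)] by (intro measure_mono_fmeasurable) auto
    also have "mass L (A - H) \<le> mass L ({0..1} - H)"
      using meas A H by (intro mass_mono[OF L]) auto
    also have "\<dots> \<le> e / 2" using rest L by blast
    finally have "mass L A \<le> measure lebesgue A * M + e / 2"
      using M by (simp add: mult_right_mono)
    also have "measure lebesgue A * M \<le> measure lebesgue A * (M + 1)" by (simp add: mult_left_mono)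
    also have "\<dots> \<le> e / 2" using A(3) M by (simp add: field_simps)
    finally show "mass L A \<le> e" by simp
  qed
qed

end

section \<open>Riemann sums over countable partitions\<close>

context positive_variational
begin

context
  fixes A :: "nat \<Rightarrow> real set" and \<tau> :: "nat \<Rightarrow> real" and e :: real
  assumes A: "range A \<subseteq> sets lebesgue" "disjoint_family A" "(\<Union>n. A n) = {0..1}"
    and osc: "\<And>n. negligible (A n) \<or> (\<forall>t\<in>A n. dist (g (\<tau> n)) (g t) \<le> e)"
    and e: "e \<ge> 0"
begin

lemma block_measurable: "A n \<in> sets lebesgue" "A n \<subseteq> {0..1}" "A n \<in> lmeasurable"
proof -
  show "A n \<in> sets lebesgue" using A(1) by blast
  moreover show "A n \<subseteq> {0..1}" using A(3) by blast
  ultimately show "A n \<in> lmeasurable" by (rule lmeasurable_unit)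
qed

lemma Riemann_sum_mass:
  assumes L: "L \<in> \<Lambda>" and I: "finite I"
  shows "\<bar>L (\<Sum>k\<in>I. measure lebesgue (A k) *\<^sub>R g (\<tau> k)) - mass L (\<Union>k\<in>I. A k)\<bar> \<le> e * (\<Sum>k\<in>I. measure lebesgue (A k))"
  using I
proof (induction I)
  case empty
  show ?case using mass_negligible[OF L, of "{}"] linear_0[OF linear_functional[OF L]] by simp
next
  case (insert n I)
  have "A n \<inter> (\<Union>k\<in>I. A k) = {}"
  proof -
    have "A n \<inter> A k = {}" if "k \<in> I" for k
    proof -
      have "n \<noteq> k" using insert.hyps that by blast
      then show ?thesis using A(2) by (simp add: disjoint_family_on_def)
    qed
    then show ?thesis by blast
  qed
  then have "mass L (A n \<union> (\<Union>k\<in>I. A k)) = mass L (A n) + mass L (\<Union>k\<in>I. A k)"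
    using block_measurable insert.hyps by (intro mass_Un[OF L] sets.finite_UN UN_least)
  moreover have "\<bar>measure lebesgue (A n) * L (g (\<tau> n)) - mass L (A n)\<bar> \<le> e * measure lebesgue (A n)"
    using oscillation_mass[OF L block_measurable(1,2) osc] .
  moreover have "L (\<Sum>k\<in>insert n I. measure lebesgue (A k) *\<^sub>R g (\<tau> k))
      = measure lebesgue (A n) * L (g (\<tau> n)) + L (\<Sum>k\<in>I. measure lebesgue (A k) *\<^sub>R g (\<tau> k))"
    using insert.hyps linear_functional[OF L] by (simp add: linear_add linear_scale)
  ultimately show ?case using insert.hyps insert.IH by (simp add: distrib_left)
qed

lemma block_measure_sums: "(\<lambda>k. measure lebesgue (A k)) sums 1"
  using measure_UNION[OF A(1,2)] A(3) by simp

text \<open>The total length of late blocks is small, so by uniform absolute continuity their union carries little mass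
  for all functionals at once; with the oscillation this controls the norm of a block sum.\<close>

lemma Riemann_sums_Cauchy:
  assumes r: "r > 0"
  shows "\<exists>m0. \<forall>m\<ge>m0. \<forall>n. norm (\<Sum>k=m..<n. measure lebesgue (A k) *\<^sub>R g (\<tau> k)) < r"
proof -
  obtain \<delta> where \<delta>: "\<delta> > 0"
    and small: "\<forall>L\<in>\<Lambda>. \<forall>A\<in>sets lebesgue. A \<subseteq> {0..1} \<and> measure lebesgue A < \<delta> \<longrightarrow> mass L A \<le> r / 3"
    using mass_uniformly_continuous[of "r / 3"] r by auto
  have "min \<delta> (r / (3 * (e + 1))) > 0" using \<delta> r e by simp
  then obtain m0 where m0: "\<forall>m\<ge>m0. \<forall>n. norm (\<Sum>k=m..<n. measure lebesgue (A k)) < min \<delta> (r / (3 * (e + 1)))"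
    using sums_summable[OF block_measure_sums] unfolding summable_Cauchy by blast
  have "norm (\<Sum>k=m..<n. measure lebesgue (A k) *\<^sub>R g (\<tau> k)) < r" if m: "m \<ge> m0" for m n
  proof -
    let ?a = "\<Sum>k=m..<n. measure lebesgue (A k)" and ?U = "\<Union>k\<in>{m..<n}. A k"
    have a: "?a < \<delta>" "?a < r / (3 * (e + 1))" "?a \<ge> 0"
      using m0 m by (auto simp: sum_nonneg dest!: spec[of _ m] spec[of _ n])
    have "norm (\<Sum>k=m..<n. measure lebesgue (A k) *\<^sub>R g (\<tau> k)) \<le> 2 * r / 3"
    proof (rule norm_le_functionals)
      fix L assume L: "L \<in> \<Lambda>"
      have U: "?U \<in> sets lebesgue" using block_measurable(1) by (intro sets.finite_UN) auto
      have U': "?U \<subseteq> {0..1}" using block_measurable(2) by (rule UN_least)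
      have "measure lebesgue ?U \<le> ?a" using block_measurable by (intro measure_UNION_le) auto
      then have "measure lebesgue ?U < \<delta>" using a by simp
      then have 1: "mass L ?U \<le> r / 3" using small L U U' by blast
      have 2: "0 \<le> mass L ?U" using L U' by (rule mass_nonneg)
      have "e * ?a \<le> (e + 1) * ?a" using a by (simp add: mult_right_mono)
      also have "\<dots> \<le> (e + 1) * (r / (3 * (e + 1)))" using a e by (intro mult_left_mono) auto
      also have "\<dots> = r / 3" using e by (simp add: field_simps)
      finally show "\<bar>L (\<Sum>k=m..<n. measure lebesgue (A k) *\<^sub>R g (\<tau> k))\<bar> \<le> 2 * r / 3"
        using Riemann_sum_mass[OF L, of "{m..<n}", OF finite_atLeastLessThan] 1 2 by linarith
    qed
    then show ?thesis using r by simp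
  qed
  then show ?thesis by blast
qed

text \<open>Finitely many blocks fill the interval up to small measure, hence carry the total mass up to \<open>r\<close>
  uniformly in the functional.\<close>

lemma Riemann_sums_near_increment:
  assumes r: "r > 0"
  shows "eventually (\<lambda>m. norm ((\<Sum>k<m. measure lebesgue (A k) *\<^sub>R g (\<tau> k)) - (F 1 - F 0)) \<le> e + r) sequentially"
proof -
  obtain \<delta> where \<delta>: "\<delta> > 0"
    and small: "\<forall>L\<in>\<Lambda>. \<forall>A\<in>sets lebesgue. A \<subseteq> {0..1} \<and> measure lebesgue A < \<delta> \<longrightarrow> mass L A \<le> r"
    by (rule mass_uniformly_continuous[OF r])
  have "eventually (\<lambda>m. (\<Sum>k<m. measure lebesgue (A k)) > 1 - \<delta>) sequentially"
    using block_measure_sums \<delta> unfolding sums_def by (intro order_tendstoD(1)) auto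
  then show ?thesis
  proof (rule eventually_mono)
    fix m assume m: "1 - \<delta> < (\<Sum>k<m. measure lebesgue (A k))"
    let ?a = "\<Sum>k<m. measure lebesgue (A k)" and ?U = "\<Union>k\<in>{..<m}. A k"
    have U: "?U \<in> sets lebesgue" "?U \<subseteq> {0..1}" "?U \<in> lmeasurable"
    proof -
      show "?U \<in> sets lebesgue" using block_measurable(1) by (intro sets.finite_UN) auto
      moreover show "?U \<subseteq> {0..1}" using block_measurable(2) by (rule UN_least)
      ultimately show "?U \<in> lmeasurable" by (rule lmeasurable_unit)
    qed
    have measU: "measure lebesgue ?U = ?a"
      using block_measurable A(2)
      by (intro measure_UNION') (auto simp: disjoint_family_on_def pairwise_def disjnt_def)
    have "measure lebesgue {0..1::real} = measure lebesgue (?U \<union> ({0..1} - ?U))"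
      using U(2) by (simp add: Un_absorb1)
    also have "\<dots> = measure lebesgue ?U + measure lebesgue (({0..1} - ?U) - ?U)"
      by (rule measure_Un2[OF U(3)]) (rule lmeasurable_unit, use U(1) in auto)
    also have "({0..1} - ?U) - ?U = {0..1} - ?U" by blast
    finally have "measure lebesgue ({0..1} - ?U) = 1 - ?a" by (simp add: measU)
    then have rest: "measure lebesgue ({0..1} - ?U) < \<delta>" and a1: "?a \<le> 1"
      using m measure_nonneg[of lebesgue "{0..1} - ?U"] by linarith+
    show "norm ((\<Sum>k<m. measure lebesgue (A k) *\<^sub>R g (\<tau> k)) - (F 1 - F 0)) \<le> e + r"
    proof (rule norm_le_functionals)
      fix L assume L: "L \<in> \<Lambda>"
      have D: "{0..1} - ?U \<in> sets lebesgue" "{0..1} - ?U \<subseteq> {0..1}" using U(1) by auto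
      have "mass L {0..1} = mass L (?U \<union> ({0..1} - ?U))" using U(2) by (simp add: Un_absorb1)
      also have "\<dots> = mass L ?U + mass L ({0..1} - ?U)"
        using U D by (intro mass_Un[OF L]) auto
      finally have 1: "L (F 1) - L (F 0) = mass L ?U + mass L ({0..1} - ?U)"
        by (simp add: mass_total[OF L])
      have 2: "mass L ({0..1} - ?U) \<le> r" "0 \<le> mass L ({0..1} - ?U)"
        using small L D rest mass_nonneg[OF L D(2)] by blast+
      have "e * ?a \<le> e" using a1 e by (simp add: mult_left_le)
      then have "\<bar>L (\<Sum>k<m. measure lebesgue (A k) *\<^sub>R g (\<tau> k)) - mass L ?U\<bar> \<le> e"
        using Riemann_sum_mass[OF L, of "{..<m}", OF finite_lessThan] by linarith
      then show "\<bar>L ((\<Sum>k<m. measure lebesgue (A k) *\<^sub>R g (\<tau> k)) - (F 1 - F 0))\<bar> \<le> e + r"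
        using 1 2 unfolding linear_diff[OF linear_functional[OF L]] by linarith
    qed
  qed
qed

end

end

theorem positive_variational_Riemann_sums:
  fixes F g :: "real \<Rightarrow> 'b::banach"
  assumes pv: "positive_variational F g \<Lambda> N"
    and A: "range A \<subseteq> sets lebesgue" "disjoint_family A" "(\<Union>n. A n) = {0..1}"
    and osc: "\<And>n. negligible (A n) \<or> (\<forall>t\<in>A n. dist (g (\<tau> n)) (g t) \<le> e)"
    and e: "e \<ge> 0"
  shows "summable (\<lambda>n. measure lebesgue (A n) *\<^sub>R g (\<tau> n))"
    and "dist (\<Sum>n. measure lebesgue (A n) *\<^sub>R g (\<tau> n)) (F 1 - F 0) \<le> e"
proof -
  show summ: "summable (\<lambda>n. measure lebesgue (A n) *\<^sub>R g (\<tau> n))"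
    unfolding summable_Cauchy
    using positive_variational.Riemann_sums_Cauchy[OF pv A osc e] by blast
  show "dist (\<Sum>n. measure lebesgue (A n) *\<^sub>R g (\<tau> n)) (F 1 - F 0) \<le> e"
  proof (rule field_le_epsilon)
    fix r :: real assume r: "r > 0"
    have "(\<lambda>m. (\<Sum>k<m. measure lebesgue (A k) *\<^sub>R g (\<tau> k)) - (F 1 - F 0))
        \<longlonglongrightarrow> (\<Sum>n. measure lebesgue (A n) *\<^sub>R g (\<tau> n)) - (F 1 - F 0)"
      using summable_LIMSEQ[OF summ] by (intro tendsto_intros)
    then show "dist (\<Sum>n. measure lebesgue (A n) *\<^sub>R g (\<tau> n)) (F 1 - F 0) \<le> e + r"
      unfolding dist_norm
      using positive_variational.Riemann_sums_near_increment[OF pv A osc e r]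
      by (rule Lim_norm_ubound[rotated]) simp
  qed
qed

section \<open>Birkhoff integrability\<close>

lemma norming_evaluations:
  "norming (range (\<lambda>f (x :: 'i::topological_space \<Rightarrow>\<^sub>C real). x f))"
  unfolding norming_def
proof (intro conjI allI impI ballI)
  fix L :: "('i \<Rightarrow>\<^sub>C real) \<Rightarrow> real" and x
  assume "L \<in> range (\<lambda>f (x :: 'i \<Rightarrow>\<^sub>C real). x f)"
  then obtain f where L: "L = (\<lambda>x. apply_bcontfun x f)" by blast
  show "linear L" unfolding L by (rule linearI) simp_all
  show "\<bar>L x\<bar> \<le> norm x" unfolding L using norm_bounded[of x f] by simp
next
  fix x :: "'i \<Rightarrow>\<^sub>C real" and r
  assume *: "\<forall>L\<in>range (\<lambda>f (x :: 'i \<Rightarrow>\<^sub>C real). x f). \<bar>L x\<bar> \<le> r"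
  have "dist x 0 \<le> r"
    by (rule dist_bound) (use * in \<open>simp add: dist_real_def\<close>)
  then show "norm x \<le> r" by simp
qed

text \<open>Additivity on intervals with a common endpoint includes degenerate ones. For \<open>a = 0\<close> it also
  says that \<open>\<Phi> {0..0}\<close> has support function \<open>0\<close>.\<close>

lemma finitely_additive_increments:
  assumes cwk: "\<Phi> \<in> closed_subintervals \<rightarrow> cwk" and add: "finitely_additive \<Phi>"
    and ab: "0 \<le> a" "a \<le> b" "b \<le> 1"
  shows "support_map (\<Phi> {a..b}) = support_map (\<Phi> {0..b}) - support_map (\<Phi> {0..a})"
proof -
  have mem: "{x..y} \<in> closed_subintervals" if "0 \<le> x" "x \<le> y" "y \<le> 1" for x y :: real
    using that by (auto simp: closed_subintervals_def)
  have "{0..a} \<union> {a..b} = {0..b}" using ab by auto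
  moreover have "interior {0..a} \<inter> interior {a..b} = {}" by auto
  ultimately have "\<Phi> {0..b} = \<Phi> {0..a} + \<Phi> {a..b}"
    using add mem[of 0 a] mem[of a b] mem[of 0 b] ab
    unfolding finitely_additive_def by (metis order_trans order_refl)
  moreover have "\<Phi> {0..a} \<in> bounded_convex" "\<Phi> {a..b} \<in> bounded_convex"
    using cwk mem ab by (auto intro!: cwk_bounded_convex)
  ultimately show ?thesis by (simp add: support_map_plus)
qed

lemma variational_primitive_support_map:
  fixes G :: "real \<Rightarrow> 'a::real_normed_vector set"
  assumes G: "G \<in> {0..1} \<rightarrow> cwk" and cwk: "\<Phi> \<in> closed_subintervals \<rightarrow> cwk" and add: "finitely_additive \<Phi>"
    and var: "\<forall>\<epsilon>>0. \<exists>\<delta> :: real \<Rightarrow> real. (\<forall>t\<in>{0..1}. \<delta> t > 0) \<and>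
           (\<forall>P. P tagged_division_of {0..1} \<and> (\<lambda>t. ball t (\<delta> t)) fine P \<longrightarrow>
              (\<Sum>(t, I)\<in>P. hausdorff_dist (\<Phi> I) ((*\<^sub>R) (measure lebesgue I) ` G t)) < \<epsilon>)"
  shows "variational_primitive (\<lambda>t. support_map (\<Phi> {0..t})) (\<lambda>t. support_map (G t))"
  unfolding variational_primitive_def
proof (intro allI impI)
  fix e :: real assume "e > 0"
  then obtain \<delta> :: "real \<Rightarrow> real" where \<delta>: "\<forall>t\<in>{0..1}. \<delta> t > 0"
    and small: "\<forall>P. P tagged_division_of {0..1} \<and> (\<lambda>t. ball t (\<delta> t)) fine P \<longrightarrow>
              (\<Sum>(t, I)\<in>P. hausdorff_dist (\<Phi> I) ((*\<^sub>R) (measure lebesgue I) ` G t)) < e"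
    using var by blast
  \<comment> \<open>Tags lie in the unit interval, so the value of the gauge elsewhere is arbitrary; it has to be positive.\<close>
  define \<delta>' where "\<delta>' t = (if t \<in> {0..1} then \<delta> t else 1)" for t
  show "\<exists>\<delta>. (\<forall>t. \<delta> t > 0) \<and> (\<forall>P. P tagged_division_of {0..1} \<and> (\<lambda>t. ball t (\<delta> t)) fine P \<longrightarrow>
      (\<Sum>(t, I)\<in>P. norm (support_map (\<Phi> {0..Sup I}) - support_map (\<Phi> {0..Inf I})
          - measure lebesgue I *\<^sub>R support_map (G t))) < e)"
  proof (intro exI[of _ \<delta>'] conjI allI impI)
    show "\<delta>' t > 0" for t using \<delta> by (simp add: \<delta>'_def)
    fix P assume "P tagged_division_of {0..1} \<and> (\<lambda>t. ball t (\<delta>' t)) fine P"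
    then have P: "P tagged_division_of {0..1}" "(\<lambda>t. ball t (\<delta>' t)) fine P" by auto
    have tag: "t \<in> {0..1}" if "(t, I) \<in> P" for t I
      using tagged_division_ofD(2,3)[OF P(1) that] by blast
    have "(\<lambda>t. ball t (\<delta> t)) fine P"
    proof (rule fineI)
      fix t I assume tI: "(t, I) \<in> P"
      then show "I \<subseteq> ball t (\<delta> t)"
        using fineD[OF P(2) tI] tag[OF tI] by (simp add: \<delta>'_def)
    qed
    then have "(\<Sum>(t, I)\<in>P. hausdorff_dist (\<Phi> I) ((*\<^sub>R) (measure lebesgue I) ` G t)) < e"
      using small P(1) by blast
    moreover have "(\<Sum>(t, I)\<in>P. norm (support_map (\<Phi> {0..Sup I}) - support_map (\<Phi> {0..Inf I})
          - measure lebesgue I *\<^sub>R support_map (G t)))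
        = (\<Sum>(t, I)\<in>P. hausdorff_dist (\<Phi> I) ((*\<^sub>R) (measure lebesgue I) ` G t))"
    proof (rule sum.cong[OF refl])
      fix p assume "p \<in> P"
      then obtain t I where p: "p = (t, I)" and tI: "(t, I) \<in> P" by (cases p) auto
      obtain a b where I: "I = {a..b}" using tagged_division_ofD(4)[OF P(1) tI] by auto
      have "t \<in> {a..b}" "{a..b} \<subseteq> {0..1}"
        using tagged_division_ofD(2,3)[OF P(1) tI] I by auto
      then have ab: "0 \<le> a" "a \<le> b" "b \<le> 1" by auto
      then have "\<Phi> I \<in> bounded_convex"
        using cwk I by (auto simp: closed_subintervals_def intro!: cwk_bounded_convex)
      moreover have Gt: "G t \<in> bounded_convex"
        using G tag[OF tI] by (auto intro!: cwk_bounded_convex)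
      ultimately have "hausdorff_dist (\<Phi> I) ((*\<^sub>R) (measure lebesgue I) ` G t)
          = norm (support_map (\<Phi> I) - measure lebesgue I *\<^sub>R support_map (G t))"
        by (simp add: dist_support_map[symmetric] bounded_convex_scaleR support_map_scaleR dist_norm)
      also have "support_map (\<Phi> I) = support_map (\<Phi> {0..Sup I}) - support_map (\<Phi> {0..Inf I})"
        using finitely_additive_increments[OF cwk add ab] ab by (simp add: I)
      finally show "(case p of (t, I) \<Rightarrow> norm (support_map (\<Phi> {0..Sup I}) - support_map (\<Phi> {0..Inf I})
          - measure lebesgue I *\<^sub>R support_map (G t)))
        = (case p of (t, I) \<Rightarrow> hausdorff_dist (\<Phi> I) ((*\<^sub>R) (measure lebesgue I) ` G t))"
        by (simp add: p)
    qed
    ultimately show "(\<Sum>(t, I)\<in>P. norm (support_map (\<Phi> {0..Sup I}) - support_map (\<Phi> {0..Inf I})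
          - measure lebesgue I *\<^sub>R support_map (G t))) < e" by simp
  qed
qed

theorem proposition4p1:
  fixes G :: "real \<Rightarrow> 'a::banach set"
  assumes "G \<in> {0..1} \<rightarrow> cwk"
    and "variationally_Henstock_integrable G"
    and "AE t in lebesgue_on {0..1}. 0 \<in> G t"
  shows "Birkhoff_integrable G"
proof -
  obtain \<Phi> where \<Phi>: "\<Phi> \<in> closed_subintervals \<rightarrow> cwk" "finitely_additive \<Phi>"
    and var: "\<forall>\<epsilon>>0. \<exists>\<delta> :: real \<Rightarrow> real. (\<forall>t\<in>{0..1}. \<delta> t > 0) \<and>
           (\<forall>P. P tagged_division_of {0..1} \<and> (\<lambda>t. ball t (\<delta> t)) fine P \<longrightarrow>
              (\<Sum>(t, I)\<in>P. hausdorff_dist (\<Phi> I) ((*\<^sub>R) (measure lebesgue I) ` G t)) < \<epsilon>)"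
    using assms(2) unfolding variationally_Henstock_integrable_def by blast
  define F where "F t = support_map (\<Phi> {0..t})" for t :: real
  define g where "g t = support_map (G t)" for t :: real
  define \<Lambda> where "\<Lambda> = range (\<lambda>f (x :: ('a \<Rightarrow>\<^sub>L real) \<Rightarrow>\<^sub>C real). x f)"
  have Gcwk: "G t \<in> cwk" if "t \<in> {0..1}" for t using assms(1) that by auto
  have vp: "variational_primitive F g"
    unfolding F_def g_def by (rule variational_primitive_support_map[OF assms(1) \<Phi> var])
  have "AE t in lebesgue. t \<in> {0..1} \<longrightarrow> 0 \<in> G t"
    using assms(3) by (simp add: AE_restrict_space_iff)
  then obtain N where N: "{t \<in> space lebesgue. \<not> (t \<in> {0..1} \<longrightarrow> 0 \<in> G t)} \<subseteq> N" "emeasure lebesgue N = 0" "N \<in> sets lebesgue"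
    by (rule AE_E)
  have pv: "positive_variational F g \<Lambda> N"
  proof
    show "variational_primitive F g" by (rule vp)
    show "norming \<Lambda>" unfolding \<Lambda>_def by (rule norming_evaluations)
    show "negligible N" unfolding negligible_iff_null_sets using N(2,3) by (rule null_setsI)
    fix L t assume L: "L \<in> \<Lambda>" and t: "t \<in> {0..1} - N"
    obtain f where f: "L = (\<lambda>x. apply_bcontfun x f)" using L unfolding \<Lambda>_def by blast
    have Gt: "G t \<in> bounded_convex" using Gcwk t by (intro cwk_bounded_convex) blast
    have "0 \<in> G t" using N(1) t by auto
    then have "dual_retraction f 0 \<le> support (G t) (dual_retraction f)"
      by (rule support_upper[OF Gt])
    then show "0 \<le> L (g t)"
      by (simp add: f g_def support_map_apply[OF Gt] blinfun.zero_right)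
  qed
  have unit: "{0..1} \<in> closed_subintervals" by (auto simp: closed_subintervals_def)
  then have \<Phi>1: "\<Phi> {0..1} \<in> cwk" using \<Phi>(1) by blast
  have F: "F 1 - F 0 = support_map (\<Phi> {0..1})"
    unfolding F_def using finitely_additive_increments[OF \<Phi>, of 0 1] by simp
  show ?thesis
    unfolding Birkhoff_integrable_def
  proof (intro bexI[OF _ \<Phi>1] allI impI)
    fix e :: real assume e: "e > 0"
    obtain B :: "nat \<Rightarrow> real set" where B: "range B \<subseteq> sets lebesgue" "disjoint_family B" "(\<Union>n. B n) = {0..1}"
      and "\<And>n. \<exists>M. \<forall>t\<in>B n. norm (g t) \<le> M"
      and osc: "\<And>n. negligible (B n) \<or> (\<forall>s\<in>B n. \<forall>t\<in>B n. dist (g s) (g t) \<le> e / 2)"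
      using small_oscillation_partition[OF vp half_gt_zero[OF e]] by metis
    have series: "\<exists>S. cwk_sums (\<lambda>n. (*\<^sub>R) (measure lebesgue (A n)) ` G (\<tau> n)) S \<and> hausdorff_dist (\<Phi> {0..1}) S < e"
      if A: "countable_partition A" "finer_than A B"
        and \<tau>: "\<forall>n. \<tau> n \<in> {0..1} \<and> (A n \<noteq> {} \<longrightarrow> \<tau> n \<in> A n)" for A \<tau>
    proof -
      \<comment> \<open>An empty block is negligible, so that its arbitrary tag does not matter.\<close>
      have oscA: "negligible (A n) \<or> (\<forall>t\<in>A n. dist (g (\<tau> n)) (g t) \<le> e / 2)" for n
      proof -
        obtain m where m: "A n \<subseteq> B m" using A(2) unfolding finer_than_def by blast
        show ?thesis using osc[of m] m \<tau> negligible_subset[OF _ m] by blast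
      qed
      have A': "range A \<subseteq> sets lebesgue" "disjoint_family A" "(\<Union>n. A n) = {0..1}"
        using A(1) unfolding countable_partition_def by auto
      have e2: "e / 2 \<ge> 0" using e by simp
      let ?C = "\<lambda>n. (*\<^sub>R) (measure lebesgue (A n)) ` G (\<tau> n)"
      have block: "support_map (?C n) = measure lebesgue (A n) *\<^sub>R g (\<tau> n)" for n
        unfolding g_def using \<tau> by (intro support_map_scaleR cwk_bounded_convex Gcwk) auto
      have C: "?C n \<in> cwk" for n using \<tau> by (intro cwk_scaleR Gcwk) blast
      have "summable (\<lambda>n. support_map (?C n))"
        unfolding block by (rule positive_variational_Riemann_sums(1)[OF pv A' oscA e2])
      then obtain S where S: "cwk_sums ?C S" "support_map S = (\<Sum>n. support_map (?C n))"
        using cwk_series[of ?C] C by blast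
      have "S \<in> cwk" using S(1) by (simp add: cwk_sums_def)
      then have "hausdorff_dist (\<Phi> {0..1}) S = dist (support_map S) (F 1 - F 0)"
        unfolding F by (subst dist_commute) (simp add: dist_support_map cwk_bounded_convex \<Phi>1)
      also have "\<dots> \<le> e / 2"
        unfolding S(2) block by (rule positive_variational_Riemann_sums(2)[OF pv A' oscA e2])
      finally show ?thesis using S(1) e by auto
    qed
    show "\<exists>A\<^sub>0. countable_partition A\<^sub>0 \<and>
        (\<forall>A t. countable_partition A \<and> finer_than A A\<^sub>0 \<and>
               (\<forall>n. t n \<in> {0..1} \<and> (A n \<noteq> {} \<longrightarrow> t n \<in> A n)) \<longrightarrow>
           unconditionally_convergent (\<lambda>n. (*\<^sub>R) (measure lebesgue (A n)) ` G (t n)) \<and>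
           (\<exists>S. cwk_sums (\<lambda>n. (*\<^sub>R) (measure lebesgue (A n)) ` G (t n)) S \<and>
                hausdorff_dist (\<Phi> {0..1}) S < e))"
    proof (intro exI[of _ B] conjI allI impI)
      show "countable_partition B" using B by (simp add: countable_partition_def)
      fix A \<tau>
      assume *: "countable_partition A \<and> finer_than A B \<and> (\<forall>n. \<tau> n \<in> {0..1} \<and> (A n \<noteq> {} \<longrightarrow> \<tau> n \<in> A n))"
      then show "\<exists>S. cwk_sums (\<lambda>n. (*\<^sub>R) (measure lebesgue (A n)) ` G (\<tau> n)) S \<and> hausdorff_dist (\<Phi> {0..1}) S < e"
        using series by blast
      show "unconditionally_convergent (\<lambda>n. (*\<^sub>R) (measure lebesgue (A n)) ` G (\<tau> n))"
        unfolding unconditionally_convergent_def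
      proof (intro allI impI)
        \<comment> \<open>A rearranged partition is again a partition finer than B, with rearranged tags.\<close>
        fix \<pi> :: "nat \<Rightarrow> nat" assume \<pi>: "bij \<pi>"
        have "(\<Union>n. A (\<pi> n)) = (\<Union>n. A n)"
          using bij_is_surj[OF \<pi>] by (metis image_image)
        moreover have "disjoint_family (\<lambda>n. A (\<pi> n))"
          using * bij_is_inj[OF \<pi>] unfolding countable_partition_def disjoint_family_on_def
          by (simp add: inj_eq)
        ultimately have "countable_partition (\<lambda>n. A (\<pi> n))"
          using * unfolding countable_partition_def by auto
        moreover have "finer_than (\<lambda>n. A (\<pi> n)) B"
          using * unfolding finer_than_def by blast
        ultimately show "\<exists>S. cwk_sums (\<lambda>n. (*\<^sub>R) (measure lebesgue (A (\<pi> n))) ` G (\<tau> (\<pi> n))) S"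
          using series[of "\<lambda>n. A (\<pi> n)" "\<lambda>n. \<tau> (\<pi> n)"] * by blast
      qed
    qed
  qed
qed

end
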